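(* Let $d\in\{2,3,\dots\}\cup\{\infty\}$ and let $\underline{A}=(A_1,\dots,A_d)$, $A_i\in B(\mathcal{H})$, be an ergodic coisometric tuple on a complex separable Hilbert space $\mathcal{H}$ with $A_i^*\Omega_{\mathcal{H}}=\overline{\omega}_i\Omega_{\mathcal{H}}$ for some unit vector $\Omega_{\mathcal{H}}\in\mathcal{H}$ and some $\underline{\omega}\in\mathbb{C}^d$ with $\sum_i|\omega_i|^2=1$. Let $\hat\theta$ be the extended characteristic function of $\underline{A}$ and let $\theta_{\mathring{A}}$ be the (Popescu) characteristic function of the $*$-stable tuple $\underline{\mathring{A}}=(\mathring{A}_1,\dots,\mathring{A}_d)$ obtained by restricting $\underline{A}$ to $\mathring{\mathcal{H}}=\mathcal{H}\ominus\mathbb{C}\Omega_{\mathcal{H}}$. Let $\gamma:\mathring{\mathcal{D}}_*\to\mathcal{D}_\omega$ be the isometry determined by $\gamma(\mathring{D}_*h)=\sum_i\langle\ell_i,h\rangle e_i$, $h\in\mathring{\mathcal{H}}$. Then for all $h\in\mathring{\mathcal{H}}$ $$\gamma\,\mathring{D}_*h=\hat D_*h,\qquad(\mathbf{1}\otimes\gamma)\,\mathring{C}h=\hat Ch,$$ and for every $i\in\{1,\dots,d\}$ $$(\mathbf{1}\otimes\gamma)\,\theta_{\mathring{A}}\big(\mathring{D}\,\iota_ih\big)=\hat\theta\big(D_A\,\iota_ih\big),$$ where $\iota_ih=(0,\dots,0,h,0,\dots,0)$ with $h$ in the $i$-th position.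
   Context: Inner products are linear in the second argument. If $d=\infty$, infinite sums of operators are strong limits and $\mathbb{C}^d=\ell^2(\mathbb{N})$. Coisometric: $\sum_iA_iA_i^*=\mathbf{1}$. Ergodic: the only fixed points of $Z(x)=\sum_iA_ixA_i^*$ on $B(\mathcal{H})$ are scalar multiples of $\mathbf{1}$. $*$-stable: $\sum_{|\alpha|=n}\|\mathring{A}_\alpha^*h\|^2\to0$ as $n\to\infty$ for all $h\in\mathring{\mathcal{H}}$. Multi-indices: $\Lambda=\{1,\dots,d\}$, $\tilde\Lambda=\bigcup_{n\ge0}\Lambda^n$ (with $\Lambda^0=\{0\}$), $|\alpha|=n$ for $\alpha\in\Lambda^n$, $T_\alpha=T_{\alpha_1}\cdots T_{\alpha_n}$, $T_0=\mathbf{1}$, $T_\alpha^*=(T_\alpha)^*$. Block form: with respect to $\mathcal{H}=\mathbb{C}\Omega_{\mathcal{H}}\oplus\mathring{\mathcal{H}}$ one has $A_i\Omega_{\mathcal{H}}=\omega_i\Omega_{\mathcal{H}}+\ell_i$ with $\ell_i\in\mathring{\mathcal{H}}$, and $\mathring{\mathcal{H}}$ is invariant under $A_i$; $\mathring{A}_i:=A_i|_{\mathring{\mathcal{H}}}\in B(\mathring{\mathcal{H}})$. Fock space: $\Gamma(\mathbb{C}^d)=\mathbb{C}e_0\oplus\mathbb{C}^d\oplus(\mathbb{C}^d)^{\otimes2}\oplus\cdots$, vacuum $e_0$, standard basis $e_1,\dots,e_d$ of $\mathbb{C}^d$, $e_\alpha=e_{\alpha_1}\otimes\cdots\otimes e_{\alpha_n}$,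 $L_ix=e_i\otimes x$ (with $L_ie_0=e_i$). Extended characteristic function: $D_A=(\mathbf{1}-\underline{A}^*\underline{A})^{1/2}$ on $\bigoplus_1^d\mathcal{H}$ (with $\underline{A}:\bigoplus_1^d\mathcal{H}\to\mathcal{H}$ the row operator) is a projection with range $\mathcal{D}_A$. Popescu's minimal isometric dilation of $\underline{A}$ on $\mathcal{H}\oplus(\Gamma(\mathbb{C}^d)\otimes\mathcal{D}_A)$ is $V_i(h\oplus\xi)=A_ih\oplus[e_0\otimes D_A\iota_ih+(L_i\otimes\mathbf{1})\xi]$. The same construction for the row $\underline{\omega}:\mathbb{C}^d\to\mathbb{C}$ gives isometries $\tilde V_i$ on $\mathbb{C}\oplus(\Gamma(\mathbb{C}^d)\otimes\mathcal{D}_\omega)$, where $\mathcal{D}_\omega=\mathbb{C}^d\ominus\mathbb{C}(\overline{\omega}_1,\dots,\overline{\omega}_d)^T$. There is a unique unitary $W:\mathcal{H}\oplus(\Gamma(\mathbb{C}^d)\otimes\mathcal{D}_A)\to\mathbb{C}\oplus(\Gamma(\mathbb{C}^d)\otimes\mathcal{D}_\omega)$ with $WV_i=\tilde V_iW$ for all $i$ and $W\Omega_{\mathcal{H}}=1\in\mathbb{C}$; it maps $\Gamma(\mathbb{C}^d)\otimes\mathcal{D}_A$ into $\Gamma(\mathbb{C}^d)\otimes\mathcal{D}_\omega$. Put $\hat C=W|_{\mathcal{H}}$ and $\hat\theta:\mathcal{D}_A\to\Gamma(\mathbb{C}^d)\otimes\mathcal{D}_\omega$, $\hat\theta(x)=W(e_0\otimes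 x)$ (the extended characteristic function). Put $\hat D_*:\mathring{\mathcal{H}}\to\mathcal{D}_\omega$, $\hat D_*h=\sum_i\langle\ell_i,h\rangle e_i$. Characteristic function of $\underline{\mathring{A}}$: $\mathring{D}_*=(\mathbf{1}-\sum_i\mathring{A}_i\mathring{A}_i^* )^{1/2}$ on $\mathring{\mathcal{H}}$ and $\mathring{D}=(\mathbf{1}-\underline{\mathring{A}}^*\underline{\mathring{A}})^{1/2}$ on $\bigoplus_1^d\mathring{\mathcal{H}}$, with closed ranges (closures of the ranges) $\mathring{\mathcal{D}}_*$ and $\mathring{\mathcal{D}}$. $\mathring{C}:\mathring{\mathcal{H}}\to\Gamma(\mathbb{C}^d)\otimes\mathring{\mathcal{D}}_*$ is the isometry $\mathring{C}h=\sum_{\alpha\in\tilde\Lambda}e_\alpha\otimes\mathring{D}_*\mathring{A}_\alpha^*h$, and $\theta_{\mathring{A}}:\mathring{\mathcal{D}}\to\Gamma(\mathbb{C}^d)\otimes\mathring{\mathcal{D}}_*$ is $$\theta_{\mathring{A}}f=-e_0\otimes\sum_{j=1}^d\mathring{A}_jP_jf+\sum_{j=1}^de_j\otimes\sum_{\alpha\in\tilde\Lambda}e_\alpha\otimes\mathring{D}_*\mathring{A}_\alpha^*P_j\mathring{D}f,$$ where $P_j$ is the projection onto the $j$-th component and $e_j\otimes e_0$ is read as $e_j$. *)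

theory Defs
  imports "HOL-Analysis.Analysis"
begin

section \<open>Complex Hilbert spaces\<close>

class scaleC =
  fixes scaleC :: "complex \<Rightarrow> 'a \<Rightarrow> 'a"  (infixr \<open>*\<^sub>C\<close> 75)

text \<open>The inner product is linear in the second argument.\<close>

class complex_inner = real_normed_vector + scaleC +
  fixes cinner :: "'a \<Rightarrow> 'a \<Rightarrow> complex"
  assumes scaleC_add_right: "c *\<^sub>C (x + y) = c *\<^sub>C x + c *\<^sub>C y"
    and scaleC_add_left: "(c + c') *\<^sub>C x = c *\<^sub>C x + c' *\<^sub>C x"
    and scaleC_scaleC: "c *\<^sub>C c' *\<^sub>C x = (c * c') *\<^sub>C x"
    and scaleC_of_real: "complex_of_real r *\<^sub>C x = r *\<^sub>R x"
    and cinner_commute: "cinner x y = cnj (cinner y x)"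
    and cinner_add_right: "cinner x (y + z) = cinner x y + cinner x z"
    and cinner_scaleC_right: "cinner x (c *\<^sub>C y) = c * cinner x y"
    and cinner_self: "cinner x x = complex_of_real ((norm x)\<^sup>2)"

class chilbert_space = complex_inner + complete_space

subclass (in chilbert_space) banach ..

lemma cinner_add_left: "cinner (x + y) z = cinner x z + cinner y (z :: 'a::complex_inner)"
proof -
  have "cinner (x + y) z = cnj (cinner z (x + y))"
    by (rule cinner_commute)
  also have "\<dots> = cnj (cinner z x) + cnj (cinner z y)"
    by (simp add: cinner_add_right)
  also have "\<dots> = cinner x z + cinner y z"
    by (simp only: cinner_commute[of x z] cinner_commute[of y z])
  finally show ?thesis .
qed

lemma norm_add_power2:
  "(norm (x + y))\<^sup>2 = (norm x)\<^sup>2 + (norm y)\<^sup>2 + 2 * Re (cinner x (y :: 'a::complex_inner))"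
proof -
  have n: "(norm z)\<^sup>2 = Re (cinner z z)" for z :: 'a
    by (simp add: cinner_self del: of_real_power)
  have "Re (cinner y x) = Re (cinner x y)"
    by (subst cinner_commute) simp
  then show ?thesis
    by (simp add: n cinner_add_left cinner_add_right)
qed

lemma norm_scaleC: "norm (c *\<^sub>C x) = cmod c * norm (x :: 'a::complex_inner)"
proof -
  have "cinner (c *\<^sub>C x) x = cnj c * cinner x x"
    by (subst cinner_commute) (simp add: cinner_scaleC_right cinner_self)
  then have "complex_of_real ((norm (c *\<^sub>C x))\<^sup>2) = c * cnj c * complex_of_real ((norm x)\<^sup>2)"
    by (simp only: cinner_self[symmetric] cinner_scaleC_right mult.assoc)
  also have "\<dots> = complex_of_real ((cmod c * norm x)\<^sup>2)"
    by (simp only: power_mult_distrib of_real_mult complex_norm_square)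
  finally have "(norm (c *\<^sub>C x))\<^sup>2 = (cmod c * norm x)\<^sup>2"
    by (simp only: of_real_eq_iff)
  then show ?thesis
    by (simp add: power2_eq_iff_nonneg)
qed

lemma complex_inner_Cauchy_Schwarz:
  "cmod (cinner x y) \<le> norm x * norm (y :: 'a::complex_inner)"
proof -
  have re: "Re (cinner x z) \<le> norm x * norm z" for z :: 'a
  proof -
    have "(norm (x + z))\<^sup>2 \<le> (norm x + norm z)\<^sup>2"
      by (simp add: norm_triangle_ineq)
    then show ?thesis
      by (simp add: norm_add_power2 power2_sum)
  qed
  define c where "c = (if cinner x y = 0 then 1 else cnj (cinner x y) / cmod (cinner x y))"
  have c: "cmod c = 1"
    by (simp add: c_def norm_divide)
  have "c * cinner x y = complex_of_real (cmod (cinner x y))"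
    by (simp add: c_def divide_simps mult.commute power2_eq_square
        flip: complex_norm_square)
  then have "Re (cinner x (c *\<^sub>C y)) = cmod (cinner x y)"
    by (simp add: cinner_scaleC_right)
  with re[of "c *\<^sub>C y"] show ?thesis
    by (simp add: norm_scaleC c)
qed

instantiation complex :: chilbert_space
begin
definition scaleC_complex :: "complex \<Rightarrow> complex \<Rightarrow> complex" where
  "scaleC_complex c x = c * x"
definition cinner_complex :: "complex \<Rightarrow> complex \<Rightarrow> complex" where
  "cinner_complex x y = cnj x * y"
instance
proof
  fix x :: complex
  show "cinner x x = complex_of_real ((norm x)\<^sup>2)"
    unfolding cinner_complex_def complex_norm_square by (rule mult.commute)
qed (simp_all add: scaleC_complex_def cinner_complex_def scaleR_conv_of_real
    distrib_left distrib_right)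
end

instantiation prod :: (complex_inner, complex_inner) complex_inner
begin
definition scaleC_prod :: "complex \<Rightarrow> 'a \<times> 'b \<Rightarrow> 'a \<times> 'b" where
  "scaleC_prod c x = (c *\<^sub>C fst x, c *\<^sub>C snd x)"
definition cinner_prod :: "'a \<times> 'b \<Rightarrow> 'a \<times> 'b \<Rightarrow> complex" where
  "cinner_prod x y = cinner (fst x) (fst y) + cinner (snd x) (snd y)"
instance
proof
  fix x y z :: "'a \<times> 'b"
  show "cinner x y = cnj (cinner y x)"
    unfolding cinner_prod_def complex_cnj_add
    by (intro arg_cong2[where f = "(+)"] cinner_commute)
  show "cinner x x = complex_of_real ((norm x)\<^sup>2)"
    by (simp add: cinner_prod_def cinner_self norm_prod_def)
qed (simp_all add: scaleC_prod_def cinner_prod_def scaleC_add_right scaleC_add_left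
    scaleC_scaleC scaleC_of_real cinner_add_right cinner_scaleC_right scaleR_prod_def
    distrib_left)
end

instance prod :: (chilbert_space, chilbert_space) chilbert_space ..

section \<open>Hilbert-space direct sums\<close>

definition ell2_norm :: "('i \<Rightarrow> 'a::complex_inner) \<Rightarrow> real" where
  "ell2_norm f = sqrt (\<Sum>\<^sub>\<infinity>i. (norm (f i))\<^sup>2)"

definition is_ell2 :: "('i \<Rightarrow> 'a::complex_inner) \<Rightarrow> bool" where
  "is_ell2 f \<longleftrightarrow> (\<lambda>i. (norm (f i))\<^sup>2) summable_on UNIV"

lemma ell2_bound:
  assumes "\<And>F. finite F \<Longrightarrow> L2_set (\<lambda>i. norm (f i)) F \<le> B"
  shows "is_ell2 f" and "ell2_norm f \<le> B"
proof -
  have B: "0 \<le> B"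
    using assms[of "{}"] by simp
  have s: "(\<Sum>i\<in>F. (norm (f i))\<^sup>2) \<le> B\<^sup>2" if "finite F" for F
  proof -
    have "(sqrt (\<Sum>i\<in>F. (norm (f i))\<^sup>2))\<^sup>2 \<le> B\<^sup>2"
      using assms[OF that] by (intro power_mono) (auto simp: L2_set_def sum_nonneg)
    then show ?thesis
      by (simp add: sum_nonneg)
  qed
  show *: "is_ell2 f"
    unfolding is_ell2_def
    by (rule nonneg_bdd_above_summable_on) (auto intro!: bdd_aboveI2[where M = "B\<^sup>2"] s)
  have "(\<Sum>\<^sub>\<infinity>i. (norm (f i))\<^sup>2) \<le> B\<^sup>2"
    by (rule infsum_le_finite_sums) (use * in \<open>auto simp: is_ell2_def s\<close>)
  then show "ell2_norm f \<le> B"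
    unfolding ell2_norm_def using B by (simp add: real_le_lsqrt infsum_nonneg)
qed

lemma L2_set_le_ell2_norm:
  assumes "is_ell2 f" "finite F"
  shows "L2_set (\<lambda>i. norm (f i)) F \<le> ell2_norm f"
  unfolding L2_set_def ell2_norm_def
  by (rule real_sqrt_le_mono, rule finite_sum_le_infsum) (use assms in \<open>auto simp: is_ell2_def\<close>)

lemma ell2_norm_power2: "(ell2_norm f)\<^sup>2 = (\<Sum>\<^sub>\<infinity>i. (norm (f i))\<^sup>2)"
  by (simp add: ell2_norm_def infsum_nonneg)

lemma ell2_add:
  assumes "is_ell2 f" "is_ell2 g"
  shows "is_ell2 (\<lambda>i. f i + g i)" and "ell2_norm (\<lambda>i. f i + g i) \<le> ell2_norm f + ell2_norm g"
proof -
  have "L2_set (\<lambda>i. norm (f i + g i)) F \<le> ell2_norm f + ell2_norm g" if "finite F" for F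
  proof -
    have "L2_set (\<lambda>i. norm (f i + g i)) F \<le> L2_set (\<lambda>i. norm (f i) + norm (g i)) F"
      by (rule L2_set_mono) (auto simp: norm_triangle_ineq)
    also have "\<dots> \<le> L2_set (\<lambda>i. norm (f i)) F + L2_set (\<lambda>i. norm (g i)) F"
      by (rule L2_set_triangle_ineq)
    also have "\<dots> \<le> ell2_norm f + ell2_norm g"
      using assms that by (intro add_mono L2_set_le_ell2_norm)
    finally show ?thesis .
  qed
  from ell2_bound[of "\<lambda>i. f i + g i", OF this]
  show "is_ell2 (\<lambda>i. f i + g i)" and "ell2_norm (\<lambda>i. f i + g i) \<le> ell2_norm f + ell2_norm g"
    by auto
qed

lemma ell2_scaleC:
  assumes "is_ell2 f"
  shows "is_ell2 (\<lambda>i. c *\<^sub>C f i)"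
  using assms unfolding is_ell2_def
  by (simp add: norm_scaleC power_mult_distrib summable_on_cmult_right)

lemma ell2_scaleR:
  assumes "is_ell2 f"
  shows "is_ell2 (\<lambda>i. r *\<^sub>R f i)"
  using ell2_scaleC[OF assms, of "complex_of_real r"] by (simp add: scaleC_of_real)

lemma ell2_uminus: "is_ell2 f \<Longrightarrow> is_ell2 (\<lambda>i. - f i)"
  by (simp add: is_ell2_def)

lemma ell2_diff: "is_ell2 f \<Longrightarrow> is_ell2 g \<Longrightarrow> is_ell2 (\<lambda>i. f i - g i)"
  using ell2_add(1)[of f "\<lambda>i. - g i"] ell2_uminus[of g] by simp

lemma ell2_zero: "is_ell2 (\<lambda>_. 0)"
  by (simp add: is_ell2_def)

lemma ell2_cinner_summable:
  assumes "is_ell2 f" "is_ell2 g"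
  shows "(\<lambda>i. cinner (f i) (g i)) summable_on UNIV"
proof -
  have *: "norm (cinner (f i) (g i)) \<le> (norm (f i))\<^sup>2 + (norm (g i))\<^sup>2" for i
  proof -
    have "norm (cinner (f i) (g i)) \<le> norm (f i) * norm (g i)"
      by (rule complex_inner_Cauchy_Schwarz)
    also have "\<dots> \<le> (norm (f i))\<^sup>2 + (norm (g i))\<^sup>2"
      using sum_squares_bound[of "norm (f i)" "norm (g i)"]
        mult_nonneg_nonneg[OF norm_ge_zero norm_ge_zero, of "f i" "g i"] by linarith
    finally show ?thesis .
  qed
  have "(\<lambda>i. (norm (f i))\<^sup>2 + (norm (g i))\<^sup>2) summable_on UNIV"
    using assms by (simp add: is_ell2_def summable_on_add)
  then have "(\<lambda>i. norm (cinner (f i) (g i))) summable_on UNIV"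
    by (rule summable_on_comparison_test) (use * in auto)
  then show ?thesis
    by (rule abs_summable_summable)
qed

text \<open>The type \<open>('i, 'a) ell2\<close> is the Hilbert-space direct sum of copies of \<open>'a\<close> indexed by
  \<open>'i\<close>. In particular \<open>('i, complex) ell2\<close> is \<open>\<ell>\<^sup>2('i)\<close>, i.e. \<open>\<complex>\<^sup>d\<close> if \<open>'i\<close> has \<open>d\<close> elements.\<close>

typedef (overloaded) ('i, 'a::complex_inner) ell2 = "{f :: 'i \<Rightarrow> 'a. is_ell2 f}"
  morphisms ell2_nth Abs_ell2
  using ell2_zero by blast

lemma is_ell2_nth [simp]: "is_ell2 (ell2_nth f)"
  using ell2_nth[of f] by simp

lemma ell2_eqI: "(\<And>i. ell2_nth f i = ell2_nth g i) \<Longrightarrow> f = g"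
  by (metis ell2_nth_inject ext)

lemma Abs_ell2_nth: "is_ell2 f \<Longrightarrow> ell2_nth (Abs_ell2 f) i = f i"
  by (simp add: Abs_ell2_inverse)

instantiation ell2 :: (type, complex_inner) real_vector
begin

definition zero_ell2 :: "('a, 'b) ell2" where
  "zero_ell2 = Abs_ell2 (\<lambda>_. 0)"
definition plus_ell2 :: "('a, 'b) ell2 \<Rightarrow> ('a, 'b) ell2 \<Rightarrow> ('a, 'b) ell2" where
  "plus_ell2 f g = Abs_ell2 (\<lambda>i. ell2_nth f i + ell2_nth g i)"
definition minus_ell2 :: "('a, 'b) ell2 \<Rightarrow> ('a, 'b) ell2 \<Rightarrow> ('a, 'b) ell2" where
  "minus_ell2 f g = Abs_ell2 (\<lambda>i. ell2_nth f i - ell2_nth g i)"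
definition uminus_ell2 :: "('a, 'b) ell2 \<Rightarrow> ('a, 'b) ell2" where
  "uminus_ell2 f = Abs_ell2 (\<lambda>i. - ell2_nth f i)"
definition scaleR_ell2 :: "real \<Rightarrow> ('a, 'b) ell2 \<Rightarrow> ('a, 'b) ell2" where
  "scaleR_ell2 r f = Abs_ell2 (\<lambda>i. r *\<^sub>R ell2_nth f i)"

instance
  by standard (auto intro!: ell2_eqI simp: zero_ell2_def plus_ell2_def minus_ell2_def
      uminus_ell2_def scaleR_ell2_def Abs_ell2_nth ell2_zero ell2_add ell2_diff ell2_uminus
      ell2_scaleR scaleR_add_right scaleR_add_left)

end

lemma ell2_nth_zero [simp]: "ell2_nth 0 i = 0"
  and ell2_nth_plus [simp]: "ell2_nth (f + g) i = ell2_nth f i + ell2_nth g i"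
  and ell2_nth_minus [simp]: "ell2_nth (f - g) i = ell2_nth f i - ell2_nth g i"
  and ell2_nth_uminus [simp]: "ell2_nth (- f) i = - ell2_nth f i"
  and ell2_nth_scaleR [simp]: "ell2_nth (r *\<^sub>R f) i = r *\<^sub>R ell2_nth f i"
  by (simp_all add: zero_ell2_def plus_ell2_def minus_ell2_def uminus_ell2_def scaleR_ell2_def
      Abs_ell2_nth ell2_zero ell2_add ell2_diff ell2_uminus ell2_scaleR)

instantiation ell2 :: (type, complex_inner) complex_inner
begin

definition scaleC_ell2 :: "complex \<Rightarrow> ('a, 'b) ell2 \<Rightarrow> ('a, 'b) ell2" where
  "scaleC_ell2 c f = Abs_ell2 (\<lambda>i. c *\<^sub>C ell2_nth f i)"
definition norm_ell2 :: "('a, 'b) ell2 \<Rightarrow> real" where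
  "norm_ell2 f = sqrt (\<Sum>\<^sub>\<infinity>i. (norm (ell2_nth f i))\<^sup>2)"
definition cinner_ell2 :: "('a, 'b) ell2 \<Rightarrow> ('a, 'b) ell2 \<Rightarrow> complex" where
  "cinner_ell2 f g = (\<Sum>\<^sub>\<infinity>i. cinner (ell2_nth f i) (ell2_nth g i))"
definition sgn_ell2 :: "('a, 'b) ell2 \<Rightarrow> ('a, 'b) ell2" where
  "sgn_ell2 f = inverse (norm f) *\<^sub>R f"
definition dist_ell2 :: "('a, 'b) ell2 \<Rightarrow> ('a, 'b) ell2 \<Rightarrow> real" where
  "dist_ell2 f g = norm (f - g)"
definition uniformity_ell2 :: "(('a, 'b) ell2 \<times> ('a, 'b) ell2) filter" where
  "uniformity_ell2 = (INF e\<in>{0<..}. principal {(x, y). dist x y < e})"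
definition open_ell2 :: "('a, 'b) ell2 set \<Rightarrow> bool" where
  "open_ell2 U \<longleftrightarrow> (\<forall>x\<in>U. \<forall>\<^sub>F (x', y) in uniformity. x' = x \<longrightarrow> y \<in> U)"

lemma ell2_nth_scaleC [simp]: "ell2_nth (c *\<^sub>C (f :: ('a, 'b) ell2)) i = c *\<^sub>C ell2_nth f i"
  by (simp add: scaleC_ell2_def Abs_ell2_nth ell2_scaleC)

lemma norm_ell2_conv: "norm (f :: ('a, 'b) ell2) = ell2_norm (ell2_nth f)"
  by (simp add: norm_ell2_def ell2_norm_def)

instance
proof
  fix f g h :: "('a, 'b) ell2" and r s :: real and c c' :: complex
  show "dist f g = norm (f - g)" "sgn f = f /\<^sub>R norm f"
    by (simp_all add: dist_ell2_def sgn_ell2_def)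
  show "uniformity = (INF e\<in>{0<..}. principal {(x :: ('a, 'b) ell2, y). dist x y < e})"
    by (fact uniformity_ell2_def)
  show "open U \<longleftrightarrow> (\<forall>x\<in>U. \<forall>\<^sub>F (x', y) in uniformity. x' = x \<longrightarrow> y \<in> U)"
    for U :: "('a, 'b) ell2 set"
    by (fact open_ell2_def)
  show "norm f = 0 \<longleftrightarrow> f = 0"
  proof
    assume n: "norm f = 0"
    have "norm (ell2_nth f i) \<le> 0" for i
      using L2_set_le_ell2_norm[OF is_ell2_nth[of f], of "{i}"] n by (simp add: norm_ell2_conv)
    then show "f = 0"
      by (auto intro!: ell2_eqI)
  qed (simp add: norm_ell2_def)
  show "norm (f + g) \<le> norm f + norm g"
    using ell2_add(2)[of "ell2_nth f" "ell2_nth g"] by (simp add: norm_ell2_def ell2_norm_def)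
  show "norm (r *\<^sub>R f) = \<bar>r\<bar> * norm f"
    by (simp add: norm_ell2_def power_mult_distrib infsum_cmult_right' real_sqrt_mult)
  show "c *\<^sub>C (f + g) = c *\<^sub>C f + c *\<^sub>C g" "(c + c') *\<^sub>C f = c *\<^sub>C f + c' *\<^sub>C f"
    "c *\<^sub>C c' *\<^sub>C f = (c * c') *\<^sub>C f" "complex_of_real r *\<^sub>C f = r *\<^sub>R f"
    by (auto intro!: ell2_eqI simp: scaleC_add_right scaleC_add_left scaleC_scaleC scaleC_of_real)
  show "cinner f g = cnj (cinner g f)"
    unfolding cinner_ell2_def infsum_cnj[symmetric]
    by (rule infsum_cong) (rule cinner_commute)
  show "cinner f (g + h) = cinner f g + cinner f h"
    unfolding cinner_ell2_def
    by (simp add: cinner_add_right infsum_add ell2_cinner_summable)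
  show "cinner f (c *\<^sub>C g) = c * cinner f g"
    unfolding cinner_ell2_def
    by (simp add: cinner_scaleC_right infsum_cmult_right')
  have "(\<Sum>\<^sub>\<infinity>i. cinner (ell2_nth f i) (ell2_nth f i))
      = (\<Sum>\<^sub>\<infinity>i. complex_of_real ((norm (ell2_nth f i))\<^sup>2))"
    by (simp only: cinner_self)
  also have "\<dots> = complex_of_real (\<Sum>\<^sub>\<infinity>i. (norm (ell2_nth f i))\<^sup>2)"
    by (intro infsumI has_sum_of_real has_sum_infsum) (use is_ell2_nth[of f] in \<open>simp add: is_ell2_def\<close>)
  finally show "cinner f f = complex_of_real ((norm f)\<^sup>2)"
    by (simp only: cinner_ell2_def norm_ell2_conv ell2_norm_power2)
qed

end

lemma norm_ell2_nth_le: "norm (ell2_nth f i) \<le> norm f"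
  using L2_set_le_ell2_norm[OF is_ell2_nth[of f], of "{i}"] by (simp add: norm_ell2_conv)

instance ell2 :: (type, chilbert_space) chilbert_space
proof
  fix X :: "nat \<Rightarrow> ('a, 'b) ell2"
  assume X: "Cauchy X"
  have "Cauchy (\<lambda>n. ell2_nth (X n) i)" for i
  proof (rule metric_CauchyI)
    fix e :: real assume "0 < e"
    then obtain M where M: "\<And>m n. m \<ge> M \<Longrightarrow> n \<ge> M \<Longrightarrow> dist (X m) (X n) < e"
      using metric_CauchyD[OF X] by metis
    have "dist (ell2_nth (X m) i) (ell2_nth (X n) i) < e" if "m \<ge> M" "n \<ge> M" for m n
      using M[OF that] norm_ell2_nth_le[of "X m - X n" i] by (simp add: dist_norm)
    then show "\<exists>M. \<forall>m\<ge>M. \<forall>n\<ge>M. dist (ell2_nth (X m) i) (ell2_nth (X n) i) < e"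
      by blast
  qed
  then have "\<forall>i. \<exists>l. (\<lambda>n. ell2_nth (X n) i) \<longlonglongrightarrow> l"
    by (simp add: Cauchy_convergent_iff convergent_def)
  then obtain g where g: "\<And>i. (\<lambda>n. ell2_nth (X n) i) \<longlonglongrightarrow> g i"
    by metis
  have fin: "L2_set (\<lambda>i. norm (ell2_nth (X m) i - g i)) F \<le> e"
    if M: "\<And>m n. m \<ge> M \<Longrightarrow> n \<ge> M \<Longrightarrow> dist (X m) (X n) < e" and m: "m \<ge> M" and F: "finite F"
    for e M m F
  proof (rule LIMSEQ_le_const2)
    show "(\<lambda>n. L2_set (\<lambda>i. norm (ell2_nth (X m) i - ell2_nth (X n) i)) F)
      \<longlonglongrightarrow> L2_set (\<lambda>i. norm (ell2_nth (X m) i - g i)) F"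
      unfolding L2_set_def by (intro tendsto_intros g)
    have "L2_set (\<lambda>i. norm (ell2_nth (X m) i - ell2_nth (X n) i)) F \<le> e" if "n \<ge> M" for n
      using L2_set_le_ell2_norm[OF is_ell2_nth[of "X m - X n"] F] M[OF m that]
      by (simp add: dist_norm norm_ell2_conv)
    then show "\<exists>N. \<forall>n\<ge>N. L2_set (\<lambda>i. norm (ell2_nth (X m) i - ell2_nth (X n) i)) F \<le> e"
      by blast
  qed
  obtain M where M: "\<And>m n. m \<ge> M \<Longrightarrow> n \<ge> M \<Longrightarrow> dist (X m) (X n) < 1"
    using metric_CauchyD[OF X, of 1] by auto
  have "is_ell2 (\<lambda>i. ell2_nth (X M) i - g i)"
    by (rule ell2_bound(1)[where B = 1]) (use fin[OF M] in auto)
  from ell2_diff[OF is_ell2_nth[of "X M"] this] have "is_ell2 g"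
    by simp
  then have G: "ell2_nth (Abs_ell2 g) i = g i" for i
    by (rule Abs_ell2_nth)
  have "X \<longlonglongrightarrow> Abs_ell2 g"
  proof (rule metric_LIMSEQ_I)
    fix e :: real assume e: "0 < e"
    then obtain M where M: "\<And>m n. m \<ge> M \<Longrightarrow> n \<ge> M \<Longrightarrow> dist (X m) (X n) < e / 2"
      using metric_CauchyD[OF X, of "e / 2"] by (metis half_gt_zero)
    have "norm (X m - Abs_ell2 g) \<le> e / 2" if "m \<ge> M" for m
      using ell2_bound(2)[of "ell2_nth (X m - Abs_ell2 g)" "e / 2"] fin[OF M that]
      by (simp add: norm_ell2_conv G)
    then show "\<exists>N. \<forall>n\<ge>N. dist (X n) (Abs_ell2 g) < e"
      using e by (intro exI[of _ M]) (force simp: dist_norm)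
  qed
  then show "convergent X"
    by (auto simp: convergent_def)
qed

text \<open>\<open>ell2_single i x\<close> has \<open>x\<close> in position \<open>i\<close> and \<open>0\<close> elsewhere. It serves as the embedding
  \<open>\<iota>\<^sub>i\<close> into a direct sum, as the standard basis vector \<open>e\<^sub>i = ell2_single i 1\<close> of \<open>\<complex>\<^sup>d\<close>, and as
  the elementary tensor \<open>e\<^sub>\<alpha> \<otimes> x\<close> in \<open>\<Gamma>(\<complex>\<^sup>d) \<otimes> \<K>\<close> (see below).\<close>

definition ell2_single :: "'i \<Rightarrow> 'a::complex_inner \<Rightarrow> ('i, 'a) ell2" where
  "ell2_single i x = Abs_ell2 (\<lambda>j. if j = i then x else 0)"

definition dsum :: "'a::complex_inner set \<Rightarrow> ('i, 'a) ell2 set" where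
  "dsum S = {f. \<forall>i. ell2_nth f i \<in> S}"


section \<open>Operators between closed subspaces\<close>

text \<open>Operators \<open>S \<rightarrow> T\<close> between closed subspaces \<open>S\<close>, \<open>T\<close> are represented by functions on the
  ambient spaces whose values outside \<open>S\<close> are irrelevant; adjoints and square roots are
  taken relative to \<open>S\<close> and \<open>T\<close>. The condition \<open>Q \<in> extensional S\<close> in definite descriptions only
  fixes those irrelevant values.\<close>

definition clinear_on :: "'a::complex_inner set \<Rightarrow> 'b::complex_inner set \<Rightarrow> ('a \<Rightarrow> 'b) \<Rightarrow> bool" where
  "clinear_on S T f \<longleftrightarrow> f ` S \<subseteq> T
     \<and> (\<forall>x\<in>S. \<forall>y\<in>S. f (x + y) = f x + f y)
     \<and> (\<forall>c. \<forall>x\<in>S. f (c *\<^sub>C x) = c *\<^sub>C f x)"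

definition bounded_clinear_on ::
    "'a::complex_inner set \<Rightarrow> 'b::complex_inner set \<Rightarrow> ('a \<Rightarrow> 'b) \<Rightarrow> bool" where
  "bounded_clinear_on S T f \<longleftrightarrow> clinear_on S T f \<and> (\<exists>K. \<forall>x\<in>S. norm (f x) \<le> K * norm x)"

definition isometry_on ::
    "'a::complex_inner set \<Rightarrow> 'b::complex_inner set \<Rightarrow> ('a \<Rightarrow> 'b) \<Rightarrow> bool" where
  "isometry_on S T f \<longleftrightarrow> clinear_on S T f \<and> (\<forall>x\<in>S. norm (f x) = norm x)"

definition unitary_on ::
    "'a::complex_inner set \<Rightarrow> 'b::complex_inner set \<Rightarrow> ('a \<Rightarrow> 'b) \<Rightarrow> bool" where
  "unitary_on S T f \<longleftrightarrow> isometry_on S T f \<and> f ` S = T"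

definition adj_on ::
    "'a::complex_inner set \<Rightarrow> 'b::complex_inner set \<Rightarrow> ('a \<Rightarrow> 'b) \<Rightarrow> 'b \<Rightarrow> 'a" where
  "adj_on S T f y = (THE z. z \<in> S \<and> (\<forall>x\<in>S. cinner z x = cinner y (f x)))"

abbreviation adj :: "('a::complex_inner \<Rightarrow> 'b::complex_inner) \<Rightarrow> 'b \<Rightarrow> 'a" where
  "adj \<equiv> adj_on UNIV UNIV"

definition positive_on :: "'a::complex_inner set \<Rightarrow> ('a \<Rightarrow> 'a) \<Rightarrow> bool" where
  "positive_on S Q \<longleftrightarrow> bounded_clinear_on S S Q \<and> (\<forall>x\<in>S. cinner x (Q x) \<in> \<real>\<^sub>\<ge>\<^sub>0)"

definition opsqrt_on :: "'a::complex_inner set \<Rightarrow> ('a \<Rightarrow> 'a) \<Rightarrow> 'a \<Rightarrow> 'a" where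
  "opsqrt_on S P = (THE Q. Q \<in> extensional S \<and> positive_on S Q \<and> (\<forall>x\<in>S. Q (Q x) = P x))"


section \<open>Row operators and their defects\<close>

text \<open>A \<open>d\<close>-tuple of operators is a family indexed by a countable type \<open>'i\<close> with \<open>d\<close> elements,
  \<open>d = \<infinity>\<close> included. Infinite sums of operators are taken pointwise, i.e. strongly.\<close>

definition row_op :: "('i \<Rightarrow> 'a \<Rightarrow> 'a) \<Rightarrow> ('i, 'a::complex_inner) ell2 \<Rightarrow> 'a" where
  "row_op T f = (\<Sum>\<^sub>\<infinity>i. T i (ell2_nth f i))"

definition defect_on ::
    "'a::complex_inner set \<Rightarrow> ('i \<Rightarrow> 'a \<Rightarrow> 'a) \<Rightarrow> ('i, 'a) ell2 \<Rightarrow> ('i, 'a) ell2" where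
  "defect_on S T = opsqrt_on (dsum S) (\<lambda>f. f - adj_on (dsum S) S (row_op T) (row_op T f))"

definition defect_star_on :: "'a::complex_inner set \<Rightarrow> ('i \<Rightarrow> 'a \<Rightarrow> 'a) \<Rightarrow> 'a \<Rightarrow> 'a" where
  "defect_star_on S T = opsqrt_on S (\<lambda>h. h - (\<Sum>\<^sub>\<infinity>i. T i (adj_on S S (T i) h)))"

primrec word_op :: "('i \<Rightarrow> 'a \<Rightarrow> 'a) \<Rightarrow> 'i list \<Rightarrow> 'a \<Rightarrow> 'a" where
  "word_op T [] = id"
| "word_op T (i # \<alpha>) = T i \<circ> word_op T \<alpha>"

definition coisometric :: "('i \<Rightarrow> 'a::complex_inner \<Rightarrow> 'a) \<Rightarrow> bool" where
  "coisometric A \<longleftrightarrow> (\<forall>h. ((\<lambda>i. A i (adj (A i) h)) has_sum h) UNIV)"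

definition Z_map :: "('i \<Rightarrow> 'a::complex_inner \<Rightarrow> 'a) \<Rightarrow> ('a \<Rightarrow> 'a) \<Rightarrow> 'a \<Rightarrow> 'a" where
  "Z_map A x h = (\<Sum>\<^sub>\<infinity>i. A i (x (adj (A i) h)))"

definition ergodic :: "('i \<Rightarrow> 'a::complex_inner \<Rightarrow> 'a) \<Rightarrow> bool" where
  "ergodic A \<longleftrightarrow>
     (\<forall>x. bounded_clinear_on UNIV UNIV x \<and> Z_map A x = x \<longrightarrow> (\<exists>c. x = (\<lambda>h. c *\<^sub>C h)))"


section \<open>Fock space and the isometric dilation\<close>

text \<open>Multi-indices are words, i.e. elements of \<open>'i list\<close>; the vacuum \<open>e\<^sub>0\<close> belongs to the empty
  word. As \<open>(e\<^sub>\<alpha>)\<close> is an orthonormal basis of the Fock space \<open>\<Gamma>(\<complex>\<^sup>d)\<close>, the Hilbert-space tensor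
  product \<open>\<Gamma>(\<complex>\<^sup>d) \<otimes> \<K>\<close> is realised as \<open>\<ell>\<^sup>2\<close> of all words with values in \<open>\<K>\<close>, the family
  \<open>(x\<^sub>\<alpha>)\<close> standing for \<open>\<Sum>\<^sub>\<alpha> e\<^sub>\<alpha> \<otimes> x\<^sub>\<alpha>\<close>. For a closed subspace \<open>D\<close> of \<open>\<K>\<close>, the subspace
  \<open>\<Gamma>(\<complex>\<^sup>d) \<otimes> D\<close> is \<open>dsum D\<close>.\<close>

type_synonym ('i, 'k) fock = "('i list, 'k) ell2"

text \<open>\<open>creation i\<close> is \<open>L\<^sub>i \<otimes> \<one>\<close>.\<close>

definition creation :: "'i \<Rightarrow> ('i, 'k::complex_inner) fock \<Rightarrow> ('i, 'k) fock" where
  "creation i \<xi> = Abs_ell2 (\<lambda>\<alpha>. case \<alpha> of [] \<Rightarrow> 0 | j # \<beta> \<Rightarrow> if j = i then ell2_nth \<xi> \<beta> else 0)"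

text \<open>\<open>id_tensor g\<close> is \<open>\<one> \<otimes> g\<close>, for \<open>g\<close> bounded on the space in which \<open>\<xi>\<close> takes its values.\<close>

definition id_tensor ::
    "('k::complex_inner \<Rightarrow> 'l::complex_inner) \<Rightarrow> ('i, 'k) fock \<Rightarrow> ('i, 'l) fock" where
  "id_tensor g \<xi> = Abs_ell2 (\<lambda>\<alpha>. g (ell2_nth \<xi> \<alpha>))"

definition dilation :: "('i \<Rightarrow> 'a \<Rightarrow> 'a) \<Rightarrow> 'i
    \<Rightarrow> 'a::complex_inner \<times> ('i, ('i, 'a) ell2) fock \<Rightarrow> 'a \<times> ('i, ('i, 'a) ell2) fock" where
  "dilation T i = (\<lambda>(h, \<xi>).
     (T i h, ell2_single [] (defect_on UNIV T (ell2_single i h)) + creation i \<xi>))"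


section \<open>The extended characteristic function\<close>

text \<open>The range \<open>\<D>\<^sub>A\<close> of \<open>D\<^sub>A = defect_on UNIV A\<close>. No closure is needed, since \<open>D\<^sub>A\<close> is a projection
  for coisometric \<open>A\<close>.\<close>

definition DA_space :: "('i \<Rightarrow> 'a \<Rightarrow> 'a) \<Rightarrow> ('i, 'a::complex_inner) ell2 set" where
  "DA_space A = range (defect_on UNIV A)"

text \<open>\<open>\<D>\<^sub>\<omega> = \<complex>\<^sup>d \<ominus> \<complex> (cnj \<omega>\<^sub>1, \<dots>, cnj \<omega>\<^sub>d)\<^sup>T\<close>.\<close>

definition Domega_space :: "('i \<Rightarrow> complex) \<Rightarrow> ('i, complex) ell2 set" where
  "Domega_space \<omega> = {x. cinner (Abs_ell2 (\<lambda>i. cnj (\<omega> i))) x = 0}"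

text \<open>The dilation of the row \<open>\<omega> : \<complex>\<^sup>d \<rightarrow> \<complex>\<close> is the same construction applied to the multiplication
  operators by \<open>\<omega>\<^sub>i\<close> on \<open>\<complex>\<close>. The summands of \<open>\<H> \<oplus> (\<Gamma>(\<complex>\<^sup>d) \<otimes> \<D>\<^sub>A)\<close> are embedded as
  \<open>h \<mapsto> (h, 0)\<close> and \<open>\<xi> \<mapsto> (0, \<xi>)\<close>, and likewise on the other side.\<close>

definition intertwining_unitary :: "('i \<Rightarrow> 'a::complex_inner \<Rightarrow> 'a) \<Rightarrow> 'a \<Rightarrow> ('i \<Rightarrow> complex)
    \<Rightarrow> ('a \<times> ('i, ('i, 'a) ell2) fock \<Rightarrow> complex \<times> ('i, ('i, complex) ell2) fock) \<Rightarrow> bool" where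
  "intertwining_unitary A \<Omega> \<omega> W \<longleftrightarrow>
     unitary_on (UNIV \<times> dsum (DA_space A)) (UNIV \<times> dsum (Domega_space \<omega>)) W
     \<and> (\<forall>i. \<forall>x \<in> UNIV \<times> dsum (DA_space A).
          W (dilation A i x) = dilation (\<lambda>j z. \<omega> j * z) i (W x))
     \<and> W (\<Omega>, 0) = (1, 0)"

definition C_hat :: "('a::complex_inner \<times> ('i, ('i, 'a) ell2) fock
    \<Rightarrow> complex \<times> ('i, ('i, complex) ell2) fock)
    \<Rightarrow> 'a \<Rightarrow> complex \<times> ('i, ('i, complex) ell2) fock" where
  "C_hat W h = W (h, 0)"

definition theta_hat :: "('a::complex_inner \<times> ('i, ('i, 'a) ell2) fock
    \<Rightarrow> complex \<times> ('i, ('i, complex) ell2) fock)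
    \<Rightarrow> ('i, 'a) ell2 \<Rightarrow> complex \<times> ('i, ('i, complex) ell2) fock" where
  "theta_hat W x = W (0, ell2_single [] x)"


section \<open>The restricted tuple and its characteristic function\<close>

definition H_ring :: "'a::complex_inner \<Rightarrow> 'a set" where
  "H_ring \<Omega> = {h. cinner \<Omega> h = 0}"

definition A_ring :: "('i \<Rightarrow> 'a \<Rightarrow> 'a) \<Rightarrow> 'a::complex_inner \<Rightarrow> 'i \<Rightarrow> 'a \<Rightarrow> 'a" where
  "A_ring A \<Omega> i = restrict (A i) (H_ring \<Omega>)"

definition ell :: "('i \<Rightarrow> 'a \<Rightarrow> 'a) \<Rightarrow> 'a::complex_inner \<Rightarrow> ('i \<Rightarrow> complex) \<Rightarrow> 'i \<Rightarrow> 'a" where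
  "ell A \<Omega> \<omega> i = A i \<Omega> - \<omega> i *\<^sub>C \<Omega>"

definition D_hat_star ::
    "('i \<Rightarrow> 'a \<Rightarrow> 'a) \<Rightarrow> 'a::complex_inner \<Rightarrow> ('i \<Rightarrow> complex) \<Rightarrow> 'a \<Rightarrow> ('i, complex) ell2" where
  "D_hat_star A \<Omega> \<omega> h = (\<Sum>\<^sub>\<infinity>i. cinner (ell A \<Omega> \<omega> i) h *\<^sub>C ell2_single i 1)"

definition D_ring :: "('i \<Rightarrow> 'a \<Rightarrow> 'a) \<Rightarrow> 'a::complex_inner \<Rightarrow> ('i, 'a) ell2 \<Rightarrow> ('i, 'a) ell2" where
  "D_ring A \<Omega> = defect_on (H_ring \<Omega>) (A_ring A \<Omega>)"

definition D_ring_star :: "('i \<Rightarrow> 'a \<Rightarrow> 'a) \<Rightarrow> 'a::complex_inner \<Rightarrow> 'a \<Rightarrow> 'a" where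
  "D_ring_star A \<Omega> = defect_star_on (H_ring \<Omega>) (A_ring A \<Omega>)"

definition D_ring_star_space :: "('i \<Rightarrow> 'a \<Rightarrow> 'a) \<Rightarrow> 'a::complex_inner \<Rightarrow> 'a set" where
  "D_ring_star_space A \<Omega> = closure (D_ring_star A \<Omega> ` H_ring \<Omega>)"

definition C_ring :: "('i \<Rightarrow> 'a \<Rightarrow> 'a) \<Rightarrow> 'a::complex_inner \<Rightarrow> 'a \<Rightarrow> ('i, 'a) fock" where
  "C_ring A \<Omega> h = (\<Sum>\<^sub>\<infinity>\<alpha>. ell2_single \<alpha>
     (D_ring_star A \<Omega> (adj_on (H_ring \<Omega>) (H_ring \<Omega>) (word_op (A_ring A \<Omega>) \<alpha>) h)))"

definition theta_ring ::
    "('i \<Rightarrow> 'a \<Rightarrow> 'a) \<Rightarrow> 'a::complex_inner \<Rightarrow> ('i, 'a) ell2 \<Rightarrow> ('i, 'a) fock" where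
  "theta_ring A \<Omega> f =
     - ell2_single [] (\<Sum>\<^sub>\<infinity>j. A_ring A \<Omega> j (ell2_nth f j))
     + (\<Sum>\<^sub>\<infinity>j. creation j (\<Sum>\<^sub>\<infinity>\<alpha>. ell2_single \<alpha>
         (D_ring_star A \<Omega> (adj_on (H_ring \<Omega>) (H_ring \<Omega>) (word_op (A_ring A \<Omega>) \<alpha>)
            (ell2_nth (D_ring A \<Omega> f) j)))))"

definition gamma_iso :: "('i \<Rightarrow> 'a \<Rightarrow> 'a) \<Rightarrow> 'a::complex_inner \<Rightarrow> ('i \<Rightarrow> complex)
    \<Rightarrow> 'a \<Rightarrow> ('i, complex) ell2" where
  "gamma_iso A \<Omega> \<omega> = (THE g. g \<in> extensional (D_ring_star_space A \<Omega>)
     \<and> isometry_on (D_ring_star_space A \<Omega>) (Domega_space \<omega>) g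
     \<and> (\<forall>h \<in> H_ring \<Omega>. g (D_ring_star A \<Omega> h)
          = (\<Sum>\<^sub>\<infinity>i. cinner (ell A \<Omega> \<omega> i) h *\<^sub>C ell2_single i 1)))"

end

theory Submission
  imports Defs
begin

text \<open>The defects are square roots of \<open>1 - X\<close> for selfadjoint contractions \<open>X\<close>, so they are given by
  the binomial series in \<open>X\<close>; in particular the row operator \<open>R\<close> of the restricted tuple satisfies
  \<open>R (1 - R\<^sup>*R)\<^bsup>1/2\<^esup> = (1 - R R\<^sup>*)\<^bsup>1/2\<^esup> R\<close>.

  Taking adjoints in \<open>W V\<^sub>i = Vt\<^sub>i W\<close> on vectors of \<open>\<H>\<close>, where \<open>Vt\<^sub>i\<close> is the dilation of \<open>\<omega>\<close>, shows that
  the component of \<open>W h\<close> at the word \<open>i\<alpha>\<close> is the component of \<open>W A\<^sub>i\<^sup>* h\<close> at \<open>\<alpha>\<close>, and that for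
  \<open>h \<bottom> \<Omega>\<close> the vacuum component of \<open>W h\<close> is \<open>(\<langle>\<ell>\<^sub>i, h\<rangle>)\<^sub>i\<close>. Coisometry gives
  \<open>\<parallel>D\<^sub>* h\<parallel>\<^sup>2 = \<Sum>\<^sub>i \<bar>\<langle>\<ell>\<^sub>i, h\<rangle>\<bar>\<^sup>2\<close>, so this vacuum component is \<open>\<gamma> D\<^sub>* h\<close>. Finally
  \<open>e\<^sub>0 \<otimes> D\<^sub>A \<iota>\<^sub>i h = V\<^sub>i h - A\<^sub>i h\<close> expresses the extended characteristic function through \<open>W h\<close> and
  \<open>W A\<^sub>i h\<close>.\<close>

section \<open>Complex inner product spaces\<close>

lemma scaleC_minus1: "(-1) *\<^sub>C x = - (x :: 'a::complex_inner)"
  using scaleC_of_real[of "-1" x] by simp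

lemma scaleC_zero_right [simp]: "c *\<^sub>C 0 = (0 :: 'a::complex_inner)"
  using scaleC_add_right[of c 0 "0 :: 'a"] by simp

lemma bounded_linear_scaleC: "bounded_linear (\<lambda>x :: 'a::complex_inner. c *\<^sub>C x)"
proof (rule bounded_linear_intro[where K = "cmod c"])
  show "c *\<^sub>C (r *\<^sub>R x) = r *\<^sub>R (c *\<^sub>C x)" for r and x :: 'a
    by (simp only: scaleC_of_real[symmetric] scaleC_scaleC mult.commute)
qed (simp_all add: scaleC_add_right norm_scaleC mult.commute)

lemma cinner_scaleR_right: "cinner x (r *\<^sub>R y) = r *\<^sub>R cinner x (y :: 'a::complex_inner)"
  by (simp only: scaleC_of_real[symmetric] cinner_scaleC_right scaleC_complex_def)

lemma bounded_linear_cinner_right: "bounded_linear (cinner (x :: 'a::complex_inner))"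
  by (rule bounded_linear_intro[where K = "norm x"])
    (simp_all add: cinner_add_right cinner_scaleR_right mult.commute
      complex_inner_Cauchy_Schwarz[THEN order_trans])

lemma bounded_linear_cinner_left: "bounded_linear (\<lambda>x :: 'a::complex_inner. cinner x y)"
proof -
  have "bounded_linear (\<lambda>x. cnj (cinner y x))"
    by (rule bounded_linear_compose[OF bounded_linear_cnj bounded_linear_cinner_right])
  then show ?thesis
    by (subst cinner_commute) simp
qed

lemmas cinner_zero_right [simp] = linear_0[OF bounded_linear.linear[OF bounded_linear_cinner_right]]
  and cinner_zero_left [simp] = linear_0[OF bounded_linear.linear[OF bounded_linear_cinner_left]]
  and cinner_diff_right = linear_diff[OF bounded_linear.linear[OF bounded_linear_cinner_right]]
  and cinner_diff_left = linear_diff[OF bounded_linear.linear[OF bounded_linear_cinner_left]]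
  and cinner_minus_right = linear_neg[OF bounded_linear.linear[OF bounded_linear_cinner_right]]
  and has_sum_cinner_right = has_sum_bounded_linear[OF bounded_linear_cinner_right]

lemma cinner_scaleC_left: "cinner (c *\<^sub>C x) y = cnj c * cinner x (y :: 'a::complex_inner)"
  by (subst cinner_commute, subst (2) cinner_commute) (simp add: cinner_scaleC_right)

lemma cinner_eq_zero_iff [simp]: "cinner x x = 0 \<longleftrightarrow> x = (0 :: 'a::complex_inner)"
  by (simp add: cinner_self)

section \<open>Closed complex subspaces and linear maps between them\<close>

definition closed_csubspace :: "'a::complex_inner set \<Rightarrow> bool" where
  "closed_csubspace S \<longleftrightarrow> 0 \<in> S \<and> (\<forall>x\<in>S. \<forall>y\<in>S. x + y \<in> S) \<and> (\<forall>c. \<forall>x\<in>S. c *\<^sub>C x \<in> S) \<and> closed S"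

context
  fixes S :: "'a::complex_inner set"
  assumes S: "closed_csubspace S"
begin

lemma csubspace_zero: "0 \<in> S"
  and csubspace_add: "x \<in> S \<Longrightarrow> y \<in> S \<Longrightarrow> x + y \<in> S"
  and csubspace_scaleC: "x \<in> S \<Longrightarrow> c *\<^sub>C x \<in> S"
  and csubspace_closed: "closed S"
  using S by (auto simp: closed_csubspace_def)

lemma csubspace_scaleR: "x \<in> S \<Longrightarrow> r *\<^sub>R x \<in> S"
  using csubspace_scaleC[of x "complex_of_real r"] by (simp add: scaleC_of_real)

lemma csubspace_uminus: "x \<in> S \<Longrightarrow> - x \<in> S"
  using csubspace_scaleR[of x "-1"] by simp

lemma csubspace_diff: "x \<in> S \<Longrightarrow> y \<in> S \<Longrightarrow> x - y \<in> S"
  using csubspace_add[of x "- y"] csubspace_uminus[of y] by simp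

lemma csubspace_sum: "(\<And>i. i \<in> F \<Longrightarrow> f i \<in> S) \<Longrightarrow> sum f F \<in> S"
  by (induction F rule: infinite_finite_induct) (auto simp: csubspace_zero csubspace_add)

lemma csubspace_has_sum:
  assumes "(f has_sum s) I" "\<And>i. i \<in> I \<Longrightarrow> f i \<in> S"
  shows "s \<in> S"
proof (rule Lim_in_closed_set[OF csubspace_closed])
  show "(sum f \<longlongrightarrow> s) (finite_subsets_at_top I)"
    using assms(1) by (simp add: has_sum_def)
  show "\<forall>\<^sub>F F in finite_subsets_at_top I. sum f F \<in> S"
    using assms(2) by (intro eventually_finite_subsets_at_top_weakI csubspace_sum) auto
qed simp

text \<open>The difference \<open>x - y\<close> lies in \<open>S\<close> and may itself serve as the
  test vector. This is how adjoints relative to \<open>S\<close> are identified below.\<close>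

lemma csubspace_eqI:
  assumes "x \<in> S" "y \<in> S" "\<And>z. z \<in> S \<Longrightarrow> cinner x z = cinner y z"
  shows "x = y"
proof -
  have "cinner (x - y) (x - y) = 0"
    using assms(3)[OF csubspace_diff[OF assms(1,2)]] by (simp only: cinner_diff_left) simp
  then show ?thesis
    by (simp only: cinner_eq_zero_iff) simp
qed

end

lemma closed_csubspace_UNIV [simp]: "closed_csubspace UNIV"
  by (simp add: closed_csubspace_def)

lemma closed_csubspace_orthogonal: "closed_csubspace {x. cinner a x = 0}"
proof -
  have "closed {x. cinner a x = 0}"
    by (intro closed_Collect_eq linear_continuous_on bounded_linear_cinner_right continuous_on_const)
  then show ?thesis
    by (simp add: closed_csubspace_def cinner_add_right cinner_scaleC_right)
qed

lemma clinear_onI: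
  assumes "\<And>x. x \<in> S \<Longrightarrow> f x \<in> T" "\<And>x y. x \<in> S \<Longrightarrow> y \<in> S \<Longrightarrow> f (x + y) = f x + f y"
    "\<And>c x. x \<in> S \<Longrightarrow> f (c *\<^sub>C x) = c *\<^sub>C f x"
  shows "clinear_on S T f"
  using assms by (auto simp: clinear_on_def)

context
  fixes S :: "'a::complex_inner set" and T :: "'b::complex_inner set" and f
  assumes f: "clinear_on S T f"
begin

lemma clinear_on_in: "x \<in> S \<Longrightarrow> f x \<in> T"
  and clinear_on_add: "x \<in> S \<Longrightarrow> y \<in> S \<Longrightarrow> f (x + y) = f x + f y"
  and clinear_on_scaleC: "x \<in> S \<Longrightarrow> f (c *\<^sub>C x) = c *\<^sub>C f x"
  using f by (auto simp: clinear_on_def)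

lemma clinear_on_scaleR: "x \<in> S \<Longrightarrow> f (r *\<^sub>R x) = r *\<^sub>R f x"
  using clinear_on_scaleC[of x "complex_of_real r"] by (simp add: scaleC_of_real)

lemma clinear_on_uminus: "x \<in> S \<Longrightarrow> f (- x) = - f x"
  using clinear_on_scaleR[of x "-1"] by simp

lemma clinear_on_zero: "0 \<in> S \<Longrightarrow> f 0 = 0"
  using clinear_on_scaleR[of 0 0] by simp

end

lemma clinear_on_diff:
  assumes f: "clinear_on S T f" and S: "closed_csubspace S" "x \<in> S" "y \<in> S"
  shows "f (x - y) = f x - f y"
  using clinear_on_add[OF f, of x "- y"] clinear_on_uminus[OF f, of y] S
  by (simp add: csubspace_uminus)

lemma clinear_on_sum:
  assumes f: "clinear_on S T f" and S: "closed_csubspace S" "\<And>i. i \<in> F \<Longrightarrow> g i \<in> S"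
  shows "f (sum g F) = (\<Sum>i\<in>F. f (g i))"
  using S(2) by (induction F rule: infinite_finite_induct)
    (simp_all add: clinear_on_zero[OF f] clinear_on_add[OF f] csubspace_zero[OF S(1)]
      csubspace_sum[OF S(1)])

text \<open>Partial sums and limit stay in \<open>S\<close>, where \<open>f\<close> is linear, so
  the error after applying \<open>f\<close> is at most \<open>K\<close> times the norm of
  \<open>sum g F - s\<close>.\<close>

lemma has_sum_bounded_clinear_on:
  assumes f: "bounded_clinear_on S T f" and S: "closed_csubspace S"
    and g: "(g has_sum s) I" "\<And>i. i \<in> I \<Longrightarrow> g i \<in> S"
  shows "((\<lambda>i. f (g i)) has_sum f s) I"
proof -
  from f obtain K where lin: "clinear_on S T f" and K: "\<And>x. x \<in> S \<Longrightarrow> norm (f x) \<le> K * norm x"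
    by (auto simp: bounded_clinear_on_def)
  have s: "s \<in> S"
    using csubspace_has_sum[OF S g] .
  have "((\<lambda>F. K * norm (sum g F - s)) \<longlongrightarrow> 0) (finite_subsets_at_top I)"
    using g(1) unfolding has_sum_def
    by (intro tendsto_mult_right_zero tendsto_norm_zero) (simp only: LIM_zero)
  then have "((\<lambda>F. (\<Sum>i\<in>F. f (g i)) - f s) \<longlongrightarrow> 0) (finite_subsets_at_top I)"
  proof (rule Lim_null_comparison[rotated], intro eventually_finite_subsets_at_top_weakI)
    fix F assume F: "finite F" "F \<subseteq> I"
    then have gF: "i \<in> F \<Longrightarrow> g i \<in> S" for i
      using g(2) by auto
    have "(\<Sum>i\<in>F. f (g i)) - f s = f (sum g F - s)"
      by (simp add: clinear_on_diff[OF lin S csubspace_sum[OF S gF] s] clinear_on_sum[OF lin S gF])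
    then show "norm ((\<Sum>i\<in>F. f (g i)) - f s) \<le> K * norm (sum g F - s)"
      using K[OF csubspace_diff[OF S csubspace_sum[OF S gF] s]] by simp
  qed
  then show ?thesis
    unfolding has_sum_def by (rule LIM_zero_cancel)
qed

section \<open>Riesz representation and adjoints relative to a subspace\<close>

lemma real_quadratic_nonneg_imp_zero:
  fixes a b :: real
  assumes "\<And>t. 0 \<le> 2 * t * a + t\<^sup>2 * b"
  shows "a = 0"
proof (rule ccontr)
  assume a: "a \<noteq> 0"
  \<comment> \<open>At \<open>t = - a / M\<close> the expression equals
    \<open>a^2 / M * (b / M - 2)\<close>, which is negative because \<open>M\<close> is positive and
    exceeds \<open>b\<close>.\<close>
  define M where "M = \<bar>b\<bar> + 1"
  have M: "0 < M" "b < M"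
    by (auto simp: M_def)
  have "0 \<le> 2 * (- a / M) * a + (- a / M)\<^sup>2 * b"
    by (rule assms)
  also have "\<dots> = a\<^sup>2 / M * (b / M - 2)"
    using M by (simp add: field_simps power2_eq_square)
  finally have "0 \<le> a\<^sup>2 / M * (b / M - 2)" .
  moreover have "0 < a\<^sup>2 / M"
    using a M by simp
  ultimately have "0 \<le> b / M - 2"
    by (simp only: zero_le_mult_iff) linarith
  then show False
    using M by (simp add: field_simps)
qed

lemma norm_diff_power2:
  "(norm (x - y))\<^sup>2 = (norm x)\<^sup>2 + (norm y)\<^sup>2 - 2 * Re (cinner x (y :: 'a::complex_inner))"
  using norm_add_power2[of x "- y"] by (simp add: cinner_minus_right)

text \<open>The representing vector is the minimiser of \<open>\<parallel>x\<parallel>\<^sup>2 - 2 Re \<phi>(x)\<close>: by the parallelogram law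
  every minimising sequence is Cauchy.\<close>

lemma riesz_representation:
  fixes S :: "'a::chilbert_space set"
  assumes S: "closed_csubspace S" and \<phi>: "bounded_clinear_on S UNIV \<phi>"
  shows "\<exists>z\<in>S. \<forall>x\<in>S. cinner z x = \<phi> x"
proof -
  from \<phi> obtain K where lin: "clinear_on S UNIV \<phi>" and K: "\<And>x. x \<in> S \<Longrightarrow> norm (\<phi> x) \<le> K * norm x"
    by (auto simp: bounded_clinear_on_def)
  define J where "J x = (norm x)\<^sup>2 - 2 * Re (\<phi> x)" for x
  have lower: "- K\<^sup>2 \<le> J x" if "x \<in> S" for x
  proof -
    have "Re (\<phi> x) \<le> K * norm x"
      using K[OF that] complex_Re_le_cmod[of "\<phi> x"] by simp
    moreover have "0 \<le> (norm x - K)\<^sup>2"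
      by simp
    ultimately show ?thesis
      by (simp add: J_def power2_diff mult.commute)
  qed
  define m where "m = Inf (J ` S)"
  have bdd: "bdd_below (J ` S)"
    using lower by (intro bdd_belowI2)
  have m: "m \<le> J x" if "x \<in> S" for x
    unfolding m_def using bdd that by (rule cINF_lower)
  have "\<exists>x\<in>S. J x < m + e" if "e > 0" for e
    using cINF_less_iff[of S J "m + e"] bdd that csubspace_zero[OF S] unfolding m_def by auto
  then have "\<forall>n. \<exists>x\<in>S. J x < m + inverse (Suc n)"
    by auto
  then obtain X where X: "\<And>n. X n \<in> S" "\<And>n. J (X n) < m + inverse (Suc n)"
    by metis
  \<comment> \<open>The parallelogram law compares \<open>x\<close> and \<open>y\<close> with their
    midpoint \<open>w\<close>; as \<open>J w\<close> is at least \<open>m\<close>, near-minimisers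
    are close to each other.\<close>
  have Jdiff: "(norm (x - y))\<^sup>2 \<le> 2 * (J x - m) + 2 * (J y - m)" if "x \<in> S" "y \<in> S" for x y
  proof -
    define w where "w = (1/2) *\<^sub>R (x + y)"
    have w: "w \<in> S"
      unfolding w_def using S that by (intro csubspace_scaleR csubspace_add)
    have "\<phi> w = (1/2) *\<^sub>R (\<phi> x + \<phi> y)"
      unfolding w_def using S that
      by (simp add: clinear_on_scaleR[OF lin] clinear_on_add[OF lin] csubspace_add)
    then have "Re (\<phi> w) = (Re (\<phi> x) + Re (\<phi> y)) / 2"
      by simp
    moreover have "(norm w)\<^sup>2 = (norm (x + y))\<^sup>2 / 4"
      by (simp add: w_def power_mult_distrib power_divide)
    ultimately have "4 * J w = (norm (x + y))\<^sup>2 - 4 * (Re (\<phi> x) + Re (\<phi> y))"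
      by (simp add: J_def)
    then have "(norm (x - y))\<^sup>2 = 2 * J x + 2 * J y - 4 * J w"
      by (simp add: J_def norm_add_power2 norm_diff_power2)
    then show ?thesis
      using m[OF w] by simp
  qed
  have "Cauchy X"
  proof (rule metric_CauchyI)
    fix e :: real assume e: "0 < e"
    obtain N where N: "inverse (Suc N) < e\<^sup>2 / 4"
      using reals_Archimedean[of "e\<^sup>2 / 4"] e by auto
    have small: "J (X n) - m < e\<^sup>2 / 4" if "n \<ge> N" for n
    proof -
      have "inverse (real (Suc n)) \<le> inverse (Suc N)"
        using that by (intro le_imp_inverse_le) auto
      then show ?thesis
        using X(2)[of n] N by linarith
    qed
    have "dist (X k) (X n) < e" if "k \<ge> N" "n \<ge> N" for k n
    proof -
      have "(norm (X k - X n))\<^sup>2 < e\<^sup>2"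
        using Jdiff[OF X(1) X(1), of k n] small[OF that(1)] small[OF that(2)]
        by (simp add: field_simps)
      then show ?thesis
        using e by (simp add: dist_norm power2_less_imp_less)
    qed
    then show "\<exists>N. \<forall>k\<ge>N. \<forall>n\<ge>N. dist (X k) (X n) < e"
      by blast
  qed
  then obtain z where z: "X \<longlonglongrightarrow> z"
    by (auto simp: Cauchy_convergent_iff convergent_def)
  have zS: "z \<in> S"
    using closed_sequentially[OF csubspace_closed[OF S] _ z] X(1) by auto
  have "(\<lambda>n. \<phi> (X n)) \<longlonglongrightarrow> \<phi> z"
  proof (rule LIM_zero_cancel, rule Lim_null_comparison)
    show "\<forall>\<^sub>F n in sequentially. norm (\<phi> (X n) - \<phi> z) \<le> K * norm (X n - z)"
      using K[OF csubspace_diff[OF S X(1) zS]]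
      by (simp add: clinear_on_diff[OF lin S X(1) zS])
    show "(\<lambda>n. K * norm (X n - z)) \<longlonglongrightarrow> 0"
      using z by (intro tendsto_mult_right_zero tendsto_norm_zero LIM_zero)
  qed
  then have "(\<lambda>n. J (X n)) \<longlonglongrightarrow> J z"
    unfolding J_def by (intro tendsto_intros z)
  moreover have "(\<lambda>n. m + inverse (Suc n)) \<longlonglongrightarrow> m + 0"
    by (intro tendsto_intros LIMSEQ_inverse_real_of_nat)
  ultimately have Jz: "J z \<le> m"
    using X(2) by (intro LIMSEQ_le) (auto intro!: exI[of _ 0] less_imp_le)
  have Re_eq: "Re (cinner z x) = Re (\<phi> x)" if x: "x \<in> S" for x
  proof -
    \<comment> \<open>First-order condition: moving from the minimiser \<open>z\<close> in the
      direction \<open>x\<close> cannot lower \<open>J\<close>, so the coefficient linear in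
      \<open>t\<close> must vanish.\<close>
    have "0 \<le> 2 * t * (Re (cinner z x) - Re (\<phi> x)) + t\<^sup>2 * (norm x)\<^sup>2" for t
    proof -
      have tx: "t *\<^sub>R x \<in> S"
        using S x by (rule csubspace_scaleR)
      have "J z \<le> J (z + t *\<^sub>R x)"
        using Jz m[OF csubspace_add[OF S zS tx]] by linarith
      then show ?thesis
        by (simp add: J_def norm_add_power2 clinear_on_add[OF lin zS tx] clinear_on_scaleR[OF lin x]
            cinner_scaleR_right power_mult_distrib algebra_simps)
    qed
    from real_quadratic_nonneg_imp_zero[OF this] show ?thesis
      by simp
  qed
  have "cinner z x = \<phi> x" if x: "x \<in> S" for x
  proof (rule complex_eqI)
    \<comment> \<open>The factor \<open>- \<i>\<close> turns an imaginary part into a real part,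
      which \<open>Re_eq\<close> already handles.\<close>
    have "Re (cinner z ((- \<i>) *\<^sub>C x)) = Re (\<phi> ((- \<i>) *\<^sub>C x))"
      using S x by (intro Re_eq csubspace_scaleC)
    then show "Im (cinner z x) = Im (\<phi> x)"
      by (simp only: cinner_scaleC_right clinear_on_scaleC[OF lin x] scaleC_complex_def) simp
  qed (rule Re_eq[OF x])
  with zS show ?thesis
    by blast
qed

lemma adj_on_eqI:
  assumes "closed_csubspace S" "z \<in> S" "\<And>x. x \<in> S \<Longrightarrow> cinner z x = cinner y (f x)"
  shows "adj_on S T f y = z"
  unfolding adj_on_def
  using assms by (intro the_equality conjI ballI csubspace_eqI[OF assms(1)]) auto

text \<open>Riesz applied to the functional sending \<open>x\<close> to
  \<open>cinner y (f x)\<close>, which is bounded by Cauchy-Schwarz, yields the vector that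
  \<open>adj_on\<close> describes.\<close>

lemma adj_on:
  fixes S :: "'a::chilbert_space set"
  assumes S: "closed_csubspace S" and f: "bounded_clinear_on S T f"
  shows adj_on_in: "adj_on S T f y \<in> S"
    and cinner_adj_on: "x \<in> S \<Longrightarrow> cinner (adj_on S T f y) x = cinner y (f x)"
proof -
  from f obtain K where lin: "clinear_on S T f" and K: "\<And>x. x \<in> S \<Longrightarrow> norm (f x) \<le> K * norm x"
    by (auto simp: bounded_clinear_on_def)
  have "norm (cinner y (f x)) \<le> (norm y * K) * norm x" if "x \<in> S" for x
    using complex_inner_Cauchy_Schwarz[of y "f x"]
      mult_left_mono[OF K[OF that] norm_ge_zero[of y]] by (simp add: mult.assoc)
  then have "bounded_clinear_on S UNIV (\<lambda>x. cinner y (f x))"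
    unfolding bounded_clinear_on_def
    by (auto intro!: clinear_onI exI simp: clinear_on_add[OF lin] clinear_on_scaleC[OF lin]
        cinner_add_right cinner_scaleC_right scaleC_complex_def)
  from riesz_representation[OF S this] obtain z
    where z: "z \<in> S" "\<And>x. x \<in> S \<Longrightarrow> cinner z x = cinner y (f x)"
    by blast
  with adj_on_eqI[OF S z] show "adj_on S T f y \<in> S"
    "x \<in> S \<Longrightarrow> cinner (adj_on S T f y) x = cinner y (f x)"
    by auto
qed

section \<open>Square roots of positive operators\<close>

text \<open>The Taylor coefficients of \<open>sqrt (1 - x)\<close> at \<open>0\<close>.\<close>

definition sqrt_coeff :: "nat \<Rightarrow> real" where
  "sqrt_coeff n = (-1) ^ n * ((1/2) gchoose n)"

lemma sqrt_coeff_0 [simp]: "sqrt_coeff 0 = 1"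
  by (simp add: sqrt_coeff_def)

lemma sqrt_coeff_rec: "sqrt_coeff (Suc n) = sqrt_coeff n * ((real n - 1/2) / (real n + 1))"
  by (simp add: sqrt_coeff_def gbinomial_Suc_rec gbinomial_absorb_comp field_simps)

text \<open>The recursion factor \<open>(n - 1/2) / (n + 1)\<close> is negative only at
  \<open>n = 0\<close>, so the sign switches at the first step and then stays.\<close>

lemma sqrt_coeff_nonpos: "n > 0 \<Longrightarrow> sqrt_coeff n \<le> 0"
proof (induction n)
  case (Suc n)
  show ?case
  proof (cases "n = 0")
    case False
    with Suc have "sqrt_coeff n \<le> 0" "0 \<le> (real n - 1/2) / (real n + 1)"
      by auto
    then show ?thesis
      by (simp only: sqrt_coeff_rec mult_nonpos_nonneg)
  qed (simp add: sqrt_coeff_rec)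
qed simp

text \<open>For \<open>n = m + 1\<close> the partial sum has the closed form
  \<open>(-1)^m * ((-1/2) gchoose m)\<close>, a product of the positive factors
  \<open>(k + 1/2) / (k + 1)\<close>.\<close>

lemma sum_sqrt_coeff_nonneg: "0 \<le> (\<Sum>k<n. sqrt_coeff k)"
proof (cases n)
  case (Suc m)
  have pos: "0 \<le> (-1) ^ m * ((- 1/2 :: real) gchoose m)"
  proof (induction m)
    case (Suc m)
    have "(-1) ^ Suc m * ((- 1/2 :: real) gchoose Suc m)
        = (-1) ^ m * ((- 1/2 :: real) gchoose m) * ((real m + 1/2) / (real m + 1))"
      by (simp add: gbinomial_Suc_rec field_simps)
    with Suc show ?case
      by simp
  qed simp
  have "(\<Sum>k<n. sqrt_coeff k) = (\<Sum>k\<le>m. ((1/2) gchoose k) * (- 1) ^ k)"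
    by (simp add: Suc lessThan_Suc_atMost sqrt_coeff_def mult.commute)
  also have "\<dots> = (-1) ^ m * ((1/2 - 1) gchoose m)"
    by (rule gbinomial_sum_lower_neg)
  finally show ?thesis
    using pos by simp
qed simp

lemma sum_abs_sqrt_coeff_le:
  assumes "finite F"
  shows "(\<Sum>k\<in>F. \<bar>sqrt_coeff k\<bar>) \<le> 2"
proof -
  obtain n where n: "F \<subseteq> {..<n}"
    using assms finite_nat_iff_bounded by auto
  \<comment> \<open>Only the coefficient 1 at \<open>k = 0\<close> is positive. Writing it as
    \<open>2 - 1\<close> makes the sum of absolute values equal to 2 minus a nonnegative partial
    sum.\<close>
  have "\<bar>sqrt_coeff k\<bar> = (if k = 0 then 2 else 0) - sqrt_coeff k" for k
    using sqrt_coeff_nonpos[of k] by auto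
  then have "(\<Sum>k<n. \<bar>sqrt_coeff k\<bar>) = (\<Sum>k<n. if k = 0 then 2 else 0) - (\<Sum>k<n. sqrt_coeff k)"
    by (simp only: sum_subtractf)
  also have "\<dots> \<le> 2"
    using sum_sqrt_coeff_nonneg[of n] by simp
  finally show ?thesis
    using n sum_mono2[of "{..<n}" F "\<lambda>k. \<bar>sqrt_coeff k\<bar>"] by simp
qed

lemma sqrt_coeff_abs_summable: "(\<lambda>n. norm (sqrt_coeff n)) summable_on UNIV"
  by (rule nonneg_bdd_above_summable_on)
    (auto intro!: bdd_aboveI2[where M = 2] sum_abs_sqrt_coeff_le)

text \<open>The series squares to \<open>1 - x\<close>: Vandermonde's identity turns the convolution
  into \<open>1 gchoose n\<close> up to sign.\<close>

lemma sqrt_coeff_convolution: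
  "(\<Sum>k\<le>n. sqrt_coeff k * sqrt_coeff (n - k)) = (if n = 0 then 1 else if n = 1 then -1 else 0)"
proof -
  have "(\<Sum>k\<le>n. sqrt_coeff k * sqrt_coeff (n - k))
      = (\<Sum>k=0..n. (-1) ^ n * (((1/2) gchoose k) * ((1/2) gchoose (n - k))))"
    unfolding atMost_atLeast0
  proof (rule sum.cong)
    fix k assume "k \<in> {0..n}"
    then have "(-1) ^ n = (-1) ^ k * (-1 :: real) ^ (n - k)"
      by (simp flip: power_add)
    then show "sqrt_coeff k * sqrt_coeff (n - k)
        = (-1) ^ n * (((1/2) gchoose k) * ((1/2) gchoose (n - k)))"
      by (simp add: sqrt_coeff_def)
  qed simp
  also have "\<dots> = (-1) ^ n * ((1 :: real) gchoose n)"
    by (simp only: sum_distrib_left[symmetric] gbinomial_Vandermonde) simp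
  also have "\<dots> = (-1) ^ n * real (1 choose n)"
    by (simp add: binomial_gbinomial)
  finally show ?thesis
    by (auto simp: binomial_eq_0)
qed

section \<open>The binomial series of a selfadjoint contraction\<close>

definition sqrt_series :: "('a \<Rightarrow> 'a::complex_inner) \<Rightarrow> 'a \<Rightarrow> 'a" where
  "sqrt_series X h = (\<Sum>\<^sub>\<infinity>n. sqrt_coeff n *\<^sub>R (X ^^ n) h)"

locale selfadjoint_contraction =
  fixes S :: "'a::chilbert_space set" and X :: "'a \<Rightarrow> 'a"
  assumes subspace: "closed_csubspace S"
    and lin: "clinear_on S S X"
    and contraction: "x \<in> S \<Longrightarrow> norm (X x) \<le> norm x"
    and selfadjoint: "x \<in> S \<Longrightarrow> y \<in> S \<Longrightarrow> cinner (X x) y = cinner x (X y)"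
begin

lemma iter_in: "x \<in> S \<Longrightarrow> (X ^^ n) x \<in> S"
  by (induction n) (auto intro: clinear_on_in[OF lin])

lemma norm_iter: "x \<in> S \<Longrightarrow> norm ((X ^^ n) x) \<le> norm x"
  by (induction n) (auto intro: order_trans[OF contraction] iter_in)

lemma iter_clinear: "clinear_on S S (X ^^ n)"
proof (induction n)
  case (Suc n)
  show ?case
    by (rule clinear_onI)
      (simp_all add: iter_in clinear_on_in[OF lin] clinear_on_add[OF Suc] clinear_on_add[OF lin]
        clinear_on_scaleC[OF Suc] clinear_on_scaleC[OF lin])
qed (simp add: clinear_on_def)

lemma bounded_iter: "bounded_clinear_on S S (X ^^ n)"
  unfolding bounded_clinear_on_def
  using iter_clinear norm_iter by (auto intro!: exI[of _ 1])

lemma iter_selfadjoint: "x \<in> S \<Longrightarrow> y \<in> S \<Longrightarrow> cinner ((X ^^ n) x) y = cinner x ((X ^^ n) y)"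
proof (induction n arbitrary: y)
  case (Suc n)
  have "cinner ((X ^^ Suc n) x) y = cinner ((X ^^ n) x) (X y)"
    using Suc.prems by (simp add: selfadjoint iter_in)
  also have "\<dots> = cinner x ((X ^^ n) (X y))"
    using Suc by (simp add: clinear_on_in[OF lin])
  finally show ?case
    by (simp add: funpow_swap1)
qed simp

lemma series_abs_summable:
  assumes "x \<in> S"
  shows "(\<lambda>n. norm (sqrt_coeff n *\<^sub>R (X ^^ n) x)) summable_on UNIV"
proof (rule Infinite_Sum.abs_summable_on_comparison_test')
  show "(\<lambda>n. norm (sqrt_coeff n) * norm x) summable_on UNIV"
    by (rule summable_on_cmult_left[OF sqrt_coeff_abs_summable])
  show "norm (sqrt_coeff n *\<^sub>R (X ^^ n) x) \<le> norm (sqrt_coeff n) * norm x" for n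
    using norm_iter[OF assms, of n] by (simp add: mult_left_mono)
qed

lemma series_has_sum:
  "x \<in> S \<Longrightarrow> ((\<lambda>n. sqrt_coeff n *\<^sub>R (X ^^ n) x) has_sum sqrt_series X x) UNIV"
  unfolding sqrt_series_def
  by (rule has_sum_infsum[OF abs_summable_summable[OF series_abs_summable]])

lemma series_in: "x \<in> S \<Longrightarrow> sqrt_series X x \<in> S"
  by (rule csubspace_has_sum[OF subspace series_has_sum])
    (auto intro: csubspace_scaleR[OF subspace] iter_in)

lemma norm_series_le:
  assumes "x \<in> S"
  shows "norm (sqrt_series X x) \<le> 2 * norm x"
proof (rule Lim_norm_ubound[OF _ series_has_sum[OF assms, unfolded has_sum_def]])
  show "\<forall>\<^sub>F F in finite_subsets_at_top UNIV. norm (\<Sum>n\<in>F. sqrt_coeff n *\<^sub>R (X ^^ n) x) \<le> 2 * norm x"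
  proof (rule eventually_finite_subsets_at_top_weakI)
    fix F :: "nat set" assume "finite F"
    have "norm (\<Sum>n\<in>F. sqrt_coeff n *\<^sub>R (X ^^ n) x) \<le> (\<Sum>n\<in>F. \<bar>sqrt_coeff n\<bar> * norm x)"
      by (rule sum_norm_le) (simp add: norm_iter[OF assms] mult_left_mono)
    also have "\<dots> \<le> 2 * norm x"
      using sum_abs_sqrt_coeff_le[OF \<open>finite F\<close>] by (simp add: mult_right_mono flip: sum_distrib_right)
    finally show "norm (\<Sum>n\<in>F. sqrt_coeff n *\<^sub>R (X ^^ n) x) \<le> 2 * norm x" .
  qed
qed simp

text \<open>\<open>f\<close> intertwines all powers and, being continuous on \<open>S\<close>,
  passes through the sum. It serves for scalar multiplication, for a competing square root and for
  the row operator.\<close>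

lemma series_intertwine:
  assumes f: "bounded_clinear_on S T f" and Y: "selfadjoint_contraction T Y"
    and comm: "\<And>x. x \<in> S \<Longrightarrow> f (X x) = Y (f x)" and x: "x \<in> S"
  shows "f (sqrt_series X x) = sqrt_series Y (f x)"
proof -
  interpret Y: selfadjoint_contraction T Y
    by (rule Y)
  have lin_f: "clinear_on S T f"
    using f by (simp add: bounded_clinear_on_def)
  have "f ((X ^^ n) x) = (Y ^^ n) (f x)" for n
    using x by (induction n) (simp_all add: comm iter_in)
  then have "f (sqrt_coeff n *\<^sub>R (X ^^ n) x) = sqrt_coeff n *\<^sub>R (Y ^^ n) (f x)" for n
    by (simp add: clinear_on_scaleR[OF lin_f] iter_in x)
  moreover have "((\<lambda>n. f (sqrt_coeff n *\<^sub>R (X ^^ n) x)) has_sum f (sqrt_series X x)) UNIV"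
    by (rule has_sum_bounded_clinear_on[OF f subspace series_has_sum[OF x]])
      (simp add: csubspace_scaleR[OF subspace] iter_in x)
  ultimately show ?thesis
    using Y.series_has_sum[OF clinear_on_in[OF lin_f x]] by (simp add: has_sum_unique)
qed

lemma series_clinear: "clinear_on S S (sqrt_series X)"
proof (rule clinear_onI)
  fix x y assume xy: "x \<in> S" "y \<in> S"
  have "((\<lambda>n. sqrt_coeff n *\<^sub>R (X ^^ n) x + sqrt_coeff n *\<^sub>R (X ^^ n) y) has_sum
      sqrt_series X x + sqrt_series X y) UNIV"
    by (intro has_sum_add series_has_sum xy)
  moreover have "sqrt_coeff n *\<^sub>R (X ^^ n) x + sqrt_coeff n *\<^sub>R (X ^^ n) y
      = sqrt_coeff n *\<^sub>R (X ^^ n) (x + y)" for n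
    by (simp add: clinear_on_add[OF iter_clinear xy] scaleR_add_right)
  ultimately show "sqrt_series X (x + y) = sqrt_series X x + sqrt_series X y"
    using series_has_sum[OF csubspace_add[OF subspace xy]] by (simp add: has_sum_unique)
next
  fix c x assume x: "x \<in> S"
  show "sqrt_series X (c *\<^sub>C x) = c *\<^sub>C sqrt_series X x"
    by (rule series_intertwine[OF _ selfadjoint_contraction_axioms _ x, symmetric])
      (auto simp: bounded_clinear_on_def norm_scaleC scaleC_add_right scaleC_scaleC mult.commute
        clinear_on_scaleC[OF lin] intro!: clinear_onI csubspace_scaleC[OF subspace]
        exI[of _ "cmod c"])
qed (rule series_in)

lemma series_bounded: "bounded_clinear_on S S (sqrt_series X)"
  using series_clinear norm_series_le by (auto simp: bounded_clinear_on_def)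

text \<open>A Cauchy product: absolute convergence allows the double series to be regrouped by total
  degree, and the convolved coefficients survive only in degrees 0 and 1.\<close>

lemma series_square:
  assumes x: "x \<in> S"
  shows "sqrt_series X (sqrt_series X x) = x - X x"
proof -
  define g where "g = (\<lambda>(n, m). (sqrt_coeff n * sqrt_coeff m) *\<^sub>R (X ^^ (n + m)) x)"
  have "(\<lambda>p. norm (g p)) summable_on UNIV \<times> UNIV"
  proof (rule Infinite_Sum.abs_summable_on_comparison_test')
    have "(\<lambda>p. norm (sqrt_coeff (fst p) * sqrt_coeff (snd p))) summable_on UNIV \<times> UNIV"
      unfolding Infinite_Sum.abs_summable_on_Sigma_iff using sqrt_coeff_abs_summable
      by (simp add: abs_mult infsum_cmult_right' summable_on_cmult_right summable_on_cmult_left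
          infsum_nonneg)
    then show "(\<lambda>p. norm (sqrt_coeff (fst p) * sqrt_coeff (snd p)) * norm x) summable_on UNIV \<times> UNIV"
      by (rule summable_on_cmult_left)
    show "norm (g p) \<le> norm (sqrt_coeff (fst p) * sqrt_coeff (snd p)) * norm x" for p
      using norm_iter[OF x] by (simp add: g_def case_prod_unfold mult_left_mono)
  qed
  then have summ: "g summable_on UNIV \<times> UNIV"
    by (rule abs_summable_summable)
  have row: "((\<lambda>m. g (n, m)) has_sum sqrt_coeff n *\<^sub>R (X ^^ n) (sqrt_series X x)) UNIV" for n
  proof -
    have "((\<lambda>m. (X ^^ n) (sqrt_coeff m *\<^sub>R (X ^^ m) x)) has_sum (X ^^ n) (sqrt_series X x)) UNIV"
      by (rule has_sum_bounded_clinear_on[OF bounded_iter subspace series_has_sum[OF x]])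
        (simp add: csubspace_scaleR[OF subspace] iter_in x)
    then have "((\<lambda>m. sqrt_coeff n *\<^sub>R (X ^^ n) (sqrt_coeff m *\<^sub>R (X ^^ m) x)) has_sum
        sqrt_coeff n *\<^sub>R (X ^^ n) (sqrt_series X x)) UNIV"
      by (rule has_sum_bounded_linear[OF bounded_linear_scaleR_right])
    then show ?thesis
      by (simp add: g_def clinear_on_scaleR[OF iter_clinear] iter_in x funpow_add)
  qed
  have "sqrt_series X (sqrt_series X x) = (\<Sum>\<^sub>\<infinity>n. \<Sum>\<^sub>\<infinity>m. g (n, m))"
    unfolding infsumI[OF row] by (simp add: sqrt_series_def)
  also have "\<dots> = infsum g (UNIV \<times> UNIV)"
    using summ by (simp add: infsum_Sigma'_banach[of "\<lambda>n m. g (n, m)"])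
  \<comment> \<open>Pairs of exponents are reindexed by their sum \<open>n\<close> and the first
    exponent \<open>k\<close>; the range \<open>k \<le> n\<close> keeps the subtraction on naturals
    exact.\<close>
  also have "\<dots> = infsum (\<lambda>(n, k). g (k, n - k)) (SIGMA n:UNIV. {..n})"
    by (rule infsum_reindex_bij_witness
        [where j = "\<lambda>(n, m). (n + m, n)" and i = "\<lambda>(n, k). (k, n - k)"]) auto
  also have "\<dots> = (\<Sum>\<^sub>\<infinity>n. \<Sum>\<^sub>\<infinity>k\<in>{..n}. g (k, n - k))"
  proof (rule infsum_Sigma'_banach[symmetric])
    show "(\<lambda>(n, k). g (k, n - k)) summable_on (SIGMA n:UNIV. {..n})"
      using summ
      by (subst summable_on_reindex_bij_witness
          [where T = "UNIV \<times> UNIV" and h = g and i = "\<lambda>(n, m). (n + m, n)" and j = "\<lambda>(n, k). (k, n - k)"])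
        auto
  qed
  also have "\<dots> = (\<Sum>\<^sub>\<infinity>n. (\<Sum>k\<le>n. sqrt_coeff k * sqrt_coeff (n - k)) *\<^sub>R (X ^^ n) x)"
    by (simp add: g_def scaleR_sum_left)
  also have "\<dots> = (\<Sum>\<^sub>\<infinity>n\<in>{0, 1}. (\<Sum>k\<le>n. sqrt_coeff k * sqrt_coeff (n - k)) *\<^sub>R (X ^^ n) x)"
    by (rule infsum_cong_neutral) (auto simp: sqrt_coeff_convolution)
  also have "\<dots> = x - X x"
    by (simp add: sqrt_coeff_convolution)
  finally show ?thesis .
qed

text \<open>The coefficients after the first are nonpositive and
  \<open>cinner x ((X ^^ n) x)\<close> is at most \<open>(norm x)^2\<close>, so every partial sum is
  at least \<open>(norm x)^2\<close> times a nonnegative partial sum of coefficients.\<close>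

lemma series_positive: "positive_on S (sqrt_series X)"
  unfolding positive_on_def
proof (intro conjI ballI series_bounded)
  fix x assume x: "x \<in> S"
  have sums: "(\<lambda>n. cinner x (sqrt_coeff n *\<^sub>R (X ^^ n) x)) sums cinner x (sqrt_series X x)"
    by (intro has_sum_imp_sums has_sum_cinner_right series_has_sum x)
  have "(\<Sum>n<N. cinner x (sqrt_coeff n *\<^sub>R (X ^^ n) x)) \<in> \<real>\<^sub>\<ge>\<^sub>0" for N
  proof -
    have real: "Im (cinner x ((X ^^ n) x)) = 0" for n
      using iter_selfadjoint[OF x x, of n] cinner_commute[of x "(X ^^ n) x"]
      by (simp add: complex_eq_iff)
    have "sqrt_coeff n * (norm x)\<^sup>2 \<le> sqrt_coeff n * Re (cinner x ((X ^^ n) x))" for n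
    proof (cases "n = 0")
      case False
      have "Re (cinner x ((X ^^ n) x)) \<le> norm x * norm ((X ^^ n) x)"
        using complex_inner_Cauchy_Schwarz complex_Re_le_cmod order_trans by blast
      also have "\<dots> \<le> (norm x)\<^sup>2"
        using norm_iter[OF x, of n] by (simp add: power2_eq_square mult_left_mono)
      finally show ?thesis
        using sqrt_coeff_nonpos[of n] False by (intro mult_left_mono_neg) auto
    qed (simp add: cinner_self flip: of_real_power)
    then have "(\<Sum>n<N. sqrt_coeff n * (norm x)\<^sup>2)
        \<le> (\<Sum>n<N. sqrt_coeff n * Re (cinner x ((X ^^ n) x)))"
      by (rule sum_mono)
    moreover have "0 \<le> (\<Sum>n<N. sqrt_coeff n * (norm x)\<^sup>2)"
      using sum_sqrt_coeff_nonneg by (simp flip: sum_distrib_right)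
    ultimately show ?thesis
      by (simp add: complex_nonneg_Reals_iff cinner_scaleR_right real)
  qed
  then show "cinner x (sqrt_series X x) \<in> \<real>\<^sub>\<ge>\<^sub>0"
    using sums unfolding sums_def by (intro Lim_in_closed_set[OF closed_nonneg_Reals_complex]) auto
qed

end

section \<open>Uniqueness of the positive square root\<close>

lemma positive_on_selfadjoint:
  assumes S: "closed_csubspace S" and Q: "positive_on S Q" and x: "x \<in> S" and y: "y \<in> S"
  shows "cinner (Q x) y = cinner x (Q y)"
proof -
  have lin: "clinear_on S S Q" and pos: "\<And>z. z \<in> S \<Longrightarrow> cinner z (Q z) \<in> \<real>\<^sub>\<ge>\<^sub>0"
    using Q by (auto simp: positive_on_def bounded_clinear_on_def)
  have real: "Im (cinner z (Q z)) = 0" if "z \<in> S" for z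
    using pos[OF that] by (simp add: complex_nonneg_Reals_iff)
  have iy: "\<i> *\<^sub>C y \<in> S"
    using S y by (rule csubspace_scaleC)
  \<comment> \<open>Polarisation: reality of the form at \<open>x + y\<close> controls imaginary
    parts, and at \<open>x + \<i> *\<^sub>C y\<close> real parts.\<close>
  have "Im (cinner x (Q y) + cinner y (Q x)) = 0"
    using real[OF csubspace_add[OF S x y]] real[OF x] real[OF y]
    by (simp add: clinear_on_add[OF lin x y] cinner_add_left cinner_add_right)
  moreover have "Re (cinner x (Q y) - cinner y (Q x)) = 0"
    using real[OF csubspace_add[OF S x iy]] real[OF x] real[OF iy]
    by (simp add: clinear_on_add[OF lin x iy] clinear_on_scaleC[OF lin y] cinner_add_left
        cinner_add_right cinner_scaleC_left cinner_scaleC_right)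
  ultimately show ?thesis
    by (subst cinner_commute) (simp add: complex_eq_iff)
qed

text \<open>Positivity at \<open>x + t *\<^sub>R Q x\<close> is a quadratic inequality in
  \<open>t\<close> without constant term, whose linear coefficient is twice
  \<open>(norm (Q x))^2\<close>.\<close>

lemma positive_on_eq_zero:
  assumes S: "closed_csubspace S" and Q: "positive_on S Q" and x: "x \<in> S"
    and zero: "cinner x (Q x) = 0"
  shows "Q x = 0"
proof -
  have lin: "clinear_on S S Q" and pos: "\<And>z. z \<in> S \<Longrightarrow> 0 \<le> Re (cinner z (Q z))"
    using Q by (auto simp: positive_on_def bounded_clinear_on_def complex_nonneg_Reals_iff)
  note in_S = x clinear_on_in[OF lin] csubspace_scaleR[OF S]
  have "0 \<le> 2 * t * (norm (Q x))\<^sup>2 + t\<^sup>2 * Re (cinner (Q x) (Q (Q x)))" for t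
  proof -
    have "0 \<le> Re (cinner (x + t *\<^sub>R Q x) (Q (x + t *\<^sub>R Q x)))"
      by (intro pos csubspace_add[OF S] in_S)
    moreover have "cinner x (Q (Q x)) = cinner (Q x) (Q x)"
      using positive_on_selfadjoint[OF S Q x, of "Q x"] in_S by simp
    ultimately show ?thesis
      by (simp add: clinear_on_add[OF lin] clinear_on_scaleR[OF lin] in_S cinner_add_left
          cinner_add_right cinner_scaleR_right zero linear_cmul[OF bounded_linear.linear[OF bounded_linear_cinner_left]]
          cinner_self algebra_simps power2_eq_square flip: of_real_power)
  qed
  then have "(norm (Q x))\<^sup>2 = 0"
    by (rule real_quadratic_nonneg_imp_zero)
  then show ?thesis
    by simp
qed

text \<open>A positive square root \<open>Q'\<close> of \<open>1 - X\<close> commutes with \<open>X\<close>, hence with the series \<open>Q\<close>; for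
  \<open>y = (Q - Q') x\<close> this gives \<open>\<langle>y, Q y\<rangle> + \<langle>y, Q' y\<rangle> = \<langle>y, (Q\<^sup>2 - Q'\<^sup>2) x\<rangle> = 0\<close>.\<close>

lemma (in selfadjoint_contraction) positive_square_root_unique:
  assumes Q: "positive_on S Q" and sq: "\<And>x. x \<in> S \<Longrightarrow> Q (Q x) = x - X x" and x: "x \<in> S"
  shows "Q x = sqrt_series X x"
proof -
  let ?R = "sqrt_series X"
  have bd: "bounded_clinear_on S S Q" and linQ: "clinear_on S S Q"
    using Q by (auto simp: positive_on_def bounded_clinear_on_def)
  have QS: "z \<in> S \<Longrightarrow> Q z \<in> S" for z
    by (rule clinear_on_in[OF linQ])
  have "Q (X z) = X (Q z)" if z: "z \<in> S" for z
  proof -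
    have "X z = z - Q (Q z)" "X (Q z) = Q z - Q (Q (Q z))"
      using sq[OF z] sq[OF QS[OF z]] by (simp_all add: algebra_simps)
    then show ?thesis
      by (simp add: clinear_on_diff[OF linQ subspace] z QS)
  qed
  from series_intertwine[OF bd selfadjoint_contraction_axioms this]
  have comm: "Q (?R z) = ?R (Q z)" if "z \<in> S" for z
    using that by blast
  define y where "y = ?R x - Q x"
  have y: "y \<in> S"
    unfolding y_def by (intro csubspace_diff[OF subspace] series_in QS x)
  have Ry: "?R y = (x - X x) - ?R (Q x)" and Qy: "Q y = ?R (Q x) - (x - X x)"
    unfolding y_def using x
    by (simp_all add: clinear_on_diff[OF series_clinear subspace] clinear_on_diff[OF linQ subspace]
        series_in QS series_square sq comm)
  have "cinner y (?R y) \<in> \<real>\<^sub>\<ge>\<^sub>0" "cinner y (Q y) \<in> \<real>\<^sub>\<ge>\<^sub>0"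
    using y series_positive Q by (auto simp: positive_on_def)
  moreover have "cinner y (?R y) + cinner y (Q y) = 0"
    by (simp add: Ry Qy flip: cinner_add_right)
  ultimately have "cinner y (?R y) = 0 \<and> cinner y (Q y) = 0"
    by (auto simp: complex_nonneg_Reals_iff complex_eq_iff)
  then have "?R y = 0" "Q y = 0"
    using positive_on_eq_zero[OF subspace _ y] series_positive Q by auto
  then have "cinner y (?R x) = 0" "cinner y (Q x) = 0"
    using positive_on_selfadjoint[OF subspace series_positive y x]
      positive_on_selfadjoint[OF subspace Q y x] by simp_all
  then have "cinner y y = 0"
    by (subst (2) y_def) (simp add: cinner_diff_right)
  then show ?thesis
    by (simp add: y_def)
qed

text \<open>Existence and uniqueness together evaluate the definite description;
  \<open>restrict\<close> supplies the values outside \<open>S\<close> that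
  \<open>extensional\<close> prescribes.\<close>

lemma (in selfadjoint_contraction) opsqrt_on_eq_series:
  assumes P: "\<And>x. x \<in> S \<Longrightarrow> P x = x - X x" and x: "x \<in> S"
  shows "opsqrt_on S P x = sqrt_series X x"
proof -
  have "opsqrt_on S P = restrict (sqrt_series X) S"
    unfolding opsqrt_on_def
  proof (rule the_equality)
    show "restrict (sqrt_series X) S \<in> extensional S \<and> positive_on S (restrict (sqrt_series X) S)
        \<and> (\<forall>x\<in>S. restrict (sqrt_series X) S (restrict (sqrt_series X) S x) = P x)"
      using series_positive
      by (auto simp: P series_square series_in positive_on_def bounded_clinear_on_def clinear_on_def
          csubspace_add[OF subspace] csubspace_scaleC[OF subspace])
  next
    fix Q assume Q: "Q \<in> extensional S \<and> positive_on S Q \<and> (\<forall>x\<in>S. Q (Q x) = P x)"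
    then have "Q x = sqrt_series X x" if "x \<in> S" for x
      using that by (intro positive_square_root_unique) (auto simp: P)
    with Q show "Q = restrict (sqrt_series X) S"
      by (intro extensionalityI[of Q S "restrict (sqrt_series X) S"]) simp_all
  qed
  with x show ?thesis
    by simp
qed

section \<open>Hilbert-space direct sums\<close>

lemma is_ell2_mono:
  assumes "is_ell2 g" "\<And>i. norm (f i) \<le> norm (g i)"
  shows "is_ell2 f"
  using assms(1) unfolding is_ell2_def
  by (rule summable_on_comparison_test) (auto intro: power_mono assms(2))

lemma has_sum_norm_ell2: "((\<lambda>i. (norm (ell2_nth f i))\<^sup>2) has_sum (norm f)\<^sup>2) UNIV"
  using is_ell2_nth[of f] by (simp add: is_ell2_def norm_ell2_conv ell2_norm_power2)

lemma bounded_linear_ell2_nth: "bounded_linear (\<lambda>f. ell2_nth f i)"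
  by (rule bounded_linear_intro[where K = 1]) (simp_all add: norm_ell2_nth_le)

lemma ell2_nth_sum: "ell2_nth (sum f F) i = (\<Sum>j\<in>F. ell2_nth (f j) i)"
  by (rule linear_sum[OF bounded_linear.linear[OF bounded_linear_ell2_nth]])

lemma is_ell2_single: "is_ell2 (\<lambda>j. if j = i then x else 0)"
proof -
  have "(\<lambda>j. (norm (if j = i then x else 0))\<^sup>2) summable_on {i}"
    by simp
  then show ?thesis
    unfolding is_ell2_def by (subst summable_on_cong_neutral[where T = "{i}"]) auto
qed

lemma ell2_single_nth [simp]: "ell2_nth (ell2_single i x) j = (if j = i then x else 0)"
  by (simp add: ell2_single_def Abs_ell2_nth[OF is_ell2_single])

lemma ell2_single_zero [simp]: "ell2_single i 0 = 0"
  by (rule ell2_eqI) simp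

lemma cinner_ell2_single_left: "cinner (ell2_single i x) f = cinner x (ell2_nth f i)"
proof -
  have "cinner (ell2_single i x) f = (\<Sum>\<^sub>\<infinity>j\<in>{i}. cinner x (ell2_nth f j))"
    unfolding cinner_ell2_def by (rule infsum_cong_neutral) auto
  then show ?thesis
    by simp
qed

lemma cinner_ell2_single_right: "cinner f (ell2_single i x) = cinner (ell2_nth f i) x"
  by (subst cinner_commute, subst (2) cinner_commute) (simp add: cinner_ell2_single_left)

text \<open>\<open>g i\<close> is the part of \<open>f\<close> on the fibre of \<open>p\<close> over
  \<open>i\<close>. With \<open>p = id\<close> this is the coordinate expansion, with
  \<open>p = hd\<close> the splitting of a Fock vector by first letters.\<close>

lemma ell2_has_sum_fibres:
  fixes g :: "'i \<Rightarrow> ('k, 'a::complex_inner) ell2"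
  assumes g: "\<And>i k. ell2_nth (g i) k = (if p k = i then ell2_nth f k else 0)"
  shows "(g has_sum f) UNIV"
  unfolding has_sum_def
proof (rule tendstoI)
  fix e :: real assume e: "0 < e"
  let ?a = "\<lambda>k. (norm (ell2_nth f k))\<^sup>2"
  have "\<forall>\<^sub>F K in finite_subsets_at_top UNIV. dist (sum ?a K) ((norm f)\<^sup>2) < e\<^sup>2"
    using has_sum_norm_ell2[of f] e unfolding has_sum_def by (intro tendstoD) auto
  then obtain K where K: "finite K" "dist (sum ?a K) ((norm f)\<^sup>2) < e\<^sup>2"
    unfolding eventually_finite_subsets_at_top by auto
  have tail: "((\<lambda>k. ?a k + - (if k \<in> K then ?a k else 0)) has_sum (norm f)\<^sup>2 + - sum ?a K) UNIV"
    using K(1)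
    by (intro has_sum_add has_sum_norm_ell2 has_sum_uminusI has_sum_finite_neutralI[where B = K]) auto
  have "dist (sum g F) f < e" if F: "finite F" "p ` K \<subseteq> F" for F
  proof -
    have nth: "ell2_nth (sum g F - f) k = (if p k \<in> F then 0 else - ell2_nth f k)" for k
      using F(1) by (simp add: ell2_nth_sum g)
    have "(norm (sum g F - f))\<^sup>2 \<le> (norm f)\<^sup>2 + - sum ?a K"
      by (rule has_sum_mono[OF has_sum_norm_ell2 tail]) (use F(2) in \<open>auto simp: nth simp del: ell2_nth_minus\<close>)
    also have "\<dots> < e\<^sup>2"
      using K(2) by (simp add: dist_real_def abs_less_iff)
    finally show ?thesis
      using e by (simp add: dist_norm power2_less_imp_less)
  qed
  then show "\<forall>\<^sub>F F in finite_subsets_at_top UNIV. dist (sum g F) f < e"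
    using K(1) unfolding eventually_finite_subsets_at_top by (auto intro!: exI[of _ "p ` K"])
qed

lemma ell2_has_sum_single: "((\<lambda>i. ell2_single i (ell2_nth f i)) has_sum f) UNIV"
  by (rule ell2_has_sum_fibres[where p = id]) simp

lemma dsum_iff: "f \<in> dsum S \<longleftrightarrow> (\<forall>i. ell2_nth f i \<in> S)"
  by (simp add: dsum_def)

lemma closed_csubspace_dsum:
  assumes S: "closed_csubspace S"
  shows "closed_csubspace (dsum S :: ('i, 'a::complex_inner) ell2 set)"
proof -
  have "closed (\<Inter>i. (\<lambda>f :: ('i, 'a) ell2. ell2_nth f i) -` S)"
    by (intro closed_INT ballI continuous_closed_vimage csubspace_closed[OF S]
        linear_continuous_at bounded_linear_ell2_nth)
  moreover have "dsum S = (\<Inter>i. (\<lambda>f :: ('i, 'a) ell2. ell2_nth f i) -` S)"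
    by (auto simp: dsum_def)
  ultimately have "closed (dsum S :: ('i, 'a) ell2 set)"
    by simp
  then show ?thesis
    by (simp add: closed_csubspace_def dsum_iff csubspace_zero[OF S] csubspace_add[OF S]
        csubspace_scaleC[OF S])
qed

lemma dsum_UNIV [simp]: "dsum UNIV = UNIV"
  by (simp add: dsum_def)

lemma ell2_single_in_dsum: "closed_csubspace S \<Longrightarrow> x \<in> S \<Longrightarrow> ell2_single i x \<in> dsum S"
  by (simp add: dsum_def csubspace_zero)

lemma ell2_nth_creation:
  "ell2_nth (creation i \<xi>) \<alpha> = (case \<alpha> of [] \<Rightarrow> 0 | j # \<beta> \<Rightarrow> if j = i then ell2_nth \<xi> \<beta> else 0)"
proof -
  have "is_ell2 (\<lambda>\<alpha>. case \<alpha> of [] \<Rightarrow> 0 | j # \<beta> \<Rightarrow> if j = i then ell2_nth \<xi> \<beta> else 0)"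
    (is "is_ell2 ?f")
  proof -
    have "(\<lambda>\<alpha>. (norm (?f \<alpha>))\<^sup>2) summable_on range ((#) i)"
      using is_ell2_nth[of \<xi>] by (simp add: summable_on_reindex o_def is_ell2_def)
    then show ?thesis
      unfolding is_ell2_def
      by (subst summable_on_cong_neutral[where T = "range ((#) i)"]) (auto split: list.splits)
  qed
  then show ?thesis
    by (simp add: creation_def Abs_ell2_nth)
qed

lemma ell2_nth_creation_simps [simp]:
  "ell2_nth (creation i \<xi>) [] = 0"
  "ell2_nth (creation i \<xi>) (j # \<beta>) = (if j = i then ell2_nth \<xi> \<beta> else 0)"
  by (simp_all add: ell2_nth_creation)

section \<open>Contractions and their defects\<close>

text \<open>The adjoint is carried as explicit data, and only its norm is bounded: for a row
  operator the adjoint is a column, whose norm is visible from its entries.\<close>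

locale contraction_adjoint_pair =
  fixes K :: "'a::chilbert_space set" and L :: "'b::chilbert_space set" and R R'
  assumes domain: "closed_csubspace K" and codomain: "closed_csubspace L"
    and lin: "clinear_on K L R" and lin': "clinear_on L K R'"
    and adjoint: "x \<in> K \<Longrightarrow> y \<in> L \<Longrightarrow> cinner (R' y) x = cinner y (R x)"
    and norm_adjoint_le: "y \<in> L \<Longrightarrow> norm (R' y) \<le> norm y"
begin

text \<open>Cauchy-Schwarz for \<open>cinner (R' (R x)) x\<close>, whose modulus is
  \<open>(norm (R x))^2\<close>; one factor \<open>norm (R x)\<close> then cancels.\<close>

lemma norm_le:
  assumes x: "x \<in> K"
  shows "norm (R x) \<le> norm x"
proof -
  have Rx: "R x \<in> L"
    using lin x by (rule clinear_on_in)
  have "(norm (R x))\<^sup>2 = cmod (cinner (R' (R x)) x)"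
    by (simp add: adjoint[OF x Rx] cinner_self norm_power)
  also have "\<dots> \<le> norm (R' (R x)) * norm x"
    by (rule complex_inner_Cauchy_Schwarz)
  also have "\<dots> \<le> norm (R x) * norm x"
    by (intro mult_right_mono norm_adjoint_le Rx) simp
  finally have "norm (R x) * norm (R x) \<le> norm (R x) * norm x"
    by (simp add: power2_eq_square)
  then show ?thesis
    by (cases "R x = 0") simp_all
qed

lemma adjoint': "x \<in> K \<Longrightarrow> y \<in> L \<Longrightarrow> cinner x (R' y) = cinner (R x) y"
  by (subst cinner_commute, subst (2) cinner_commute) (simp add: adjoint)

lemma bounded: "bounded_clinear_on K L R"
  using lin norm_le by (auto simp: bounded_clinear_on_def intro!: exI[of _ 1])

sublocale initial: selfadjoint_contraction K "\<lambda>x. R' (R x)"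
  by standard
    (auto intro!: domain clinear_onI order_trans[OF norm_adjoint_le norm_le]
      simp: clinear_on_in[OF lin] clinear_on_in[OF lin'] clinear_on_add[OF lin]
        clinear_on_add[OF lin'] clinear_on_scaleC[OF lin] clinear_on_scaleC[OF lin'] adjoint adjoint')

sublocale final: selfadjoint_contraction L "\<lambda>y. R (R' y)"
  by standard
    (auto intro!: codomain clinear_onI order_trans[OF norm_le norm_adjoint_le]
      simp: clinear_on_in[OF lin] clinear_on_in[OF lin'] clinear_on_add[OF lin]
        clinear_on_add[OF lin'] clinear_on_scaleC[OF lin] clinear_on_scaleC[OF lin']
        adjoint[symmetric] adjoint'[symmetric])

text \<open>\<open>R\<close> intertwines \<open>R' R\<close> with \<open>R R'\<close>, hence also
  the square roots. For row operators this moves \<open>R\<close> across the two defects.\<close>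

lemma series_intertwine_pair:
  "x \<in> K \<Longrightarrow> R (sqrt_series (\<lambda>x. R' (R x)) x) = sqrt_series (\<lambda>y. R (R' y)) (R x)"
  by (rule initial.series_intertwine[OF bounded final.selfadjoint_contraction_axioms]) auto

end

text \<open>A common frame for three tuples: \<open>A\<close> on the whole space, multiplication by
  \<open>\<omega> i\<close> on the complex numbers, and the restricted tuple on
  \<open>H_ring \<Omega>\<close>.\<close>

locale row_contraction =
  fixes S :: "'a::chilbert_space set" and T Ts :: "'i \<Rightarrow> 'a \<Rightarrow> 'a"
  assumes subspace: "closed_csubspace S"
    and lin: "clinear_on S S (T i)"
    and adj_in: "y \<in> S \<Longrightarrow> Ts i y \<in> S"
    and adjoint: "x \<in> S \<Longrightarrow> y \<in> S \<Longrightarrow> cinner (Ts i y) x = cinner y (T i x)"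
    and adj_sum_le: "y \<in> S \<Longrightarrow> finite F \<Longrightarrow> (\<Sum>i\<in>F. (norm (Ts i y))\<^sup>2) \<le> (norm y)\<^sup>2"
begin

definition column :: "'a \<Rightarrow> ('i, 'a) ell2" where
  "column y = Abs_ell2 (\<lambda>i. Ts i y)"

lemma adj_on_eq: "y \<in> S \<Longrightarrow> adj_on S S (T i) y = Ts i y"
  by (rule adj_on_eqI[OF subspace]) (simp_all add: adj_in adjoint)

lemma adj_clinear: "clinear_on S S (Ts i)"
  by (intro clinear_onI csubspace_eqI[OF subspace])
    (auto simp: adj_in adjoint cinner_add_left cinner_scaleC_left csubspace_add[OF subspace]
      csubspace_scaleC[OF subspace])

lemma
  assumes "y \<in> S"
  shows column_nth: "ell2_nth (column y) i = Ts i y" and norm_column_le: "norm (column y) \<le> norm y"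
proof -
  have "L2_set (\<lambda>i. norm (Ts i y)) F \<le> norm y" if "finite F" for F
    using adj_sum_le[OF assms that] by (simp add: L2_set_def real_le_lsqrt sum_nonneg)
  from ell2_bound[OF this]
  show "ell2_nth (column y) i = Ts i y" and "norm (column y) \<le> norm y"
    by (simp_all add: column_def Abs_ell2_nth norm_ell2_conv Abs_ell2_inverse)
qed

lemma column_clinear: "clinear_on S (dsum S) column"
  by (intro clinear_onI ell2_eqI)
    (auto simp: dsum_def column_nth adj_in clinear_on_add[OF adj_clinear]
      clinear_on_scaleC[OF adj_clinear] csubspace_add[OF subspace] csubspace_scaleC[OF subspace])

lemma column_bounded: "bounded_clinear_on S (dsum S) column"
  using column_clinear norm_column_le by (auto simp: bounded_clinear_on_def intro!: exI[of _ 1])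

lemma dsum_subspace: "closed_csubspace (dsum S :: ('i, 'a) ell2 set)"
  by (rule closed_csubspace_dsum[OF subspace])

text \<open>The series defining the row operator converges because the adjoint of the column operator
  is continuous.\<close>

definition column_adj :: "('i, 'a) ell2 \<Rightarrow> 'a" where
  "column_adj = adj_on S (dsum S) column"

lemma column_adj_in: "column_adj f \<in> S"
  and cinner_column_adj: "y \<in> S \<Longrightarrow> cinner (column_adj f) y = cinner f (column y)"
  using adj_on[OF subspace column_bounded] by (auto simp: column_adj_def)

lemma column_adj_pair: "contraction_adjoint_pair (dsum S) S column_adj column"
proof
  show "clinear_on (dsum S) S column_adj"
    by (intro clinear_onI csubspace_eqI[OF subspace])
      (auto simp: column_adj_in cinner_column_adj cinner_add_left cinner_scaleC_left
        csubspace_add[OF subspace] csubspace_scaleC[OF subspace])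
  show "cinner (column y) f = cinner y (column_adj f)" if "y \<in> S" for y f
    by (subst cinner_commute, subst (2) cinner_commute) (simp add: cinner_column_adj that)
qed (auto intro: subspace dsum_subspace column_clinear norm_column_le)

lemma column_adj_single:
  assumes x: "x \<in> S"
  shows "column_adj (ell2_single i x) = T i x"
proof -
  have "cinner (T i x) y = cinner x (Ts i y)" if "y \<in> S" for y
    by (subst cinner_commute, subst (2) cinner_commute) (simp add: adjoint x that)
  then show ?thesis
    by (intro csubspace_eqI[OF subspace])
      (auto simp: column_adj_in clinear_on_in[OF lin] x cinner_column_adj cinner_ell2_single_left
        column_nth)
qed

lemma row_op_has_sum:
  assumes f: "f \<in> dsum S"
  shows "((\<lambda>i. T i (ell2_nth f i)) has_sum row_op T f) UNIV" and "row_op T f = column_adj f"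
proof -
  interpret contraction_adjoint_pair "dsum S" S column_adj column
    by (rule column_adj_pair)
  have fS: "ell2_nth f i \<in> S" for i
    using f by (simp add: dsum_def)
  have "((\<lambda>i. column_adj (ell2_single i (ell2_nth f i))) has_sum column_adj f) UNIV"
    by (rule has_sum_bounded_clinear_on[OF bounded dsum_subspace ell2_has_sum_single])
      (simp add: ell2_single_in_dsum subspace fS)
  then have *: "((\<lambda>i. T i (ell2_nth f i)) has_sum column_adj f) UNIV"
    by (simp add: column_adj_single fS)
  then show "row_op T f = column_adj f"
    unfolding row_op_def by (rule infsumI)
  with * show "((\<lambda>i. T i (ell2_nth f i)) has_sum row_op T f) UNIV"
    by simp
qed

lemma row_op_single: "x \<in> S \<Longrightarrow> row_op T (ell2_single i x) = T i x"
  by (simp add: row_op_has_sum(2) ell2_single_in_dsum subspace column_adj_single)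

sublocale row: contraction_adjoint_pair "dsum S" S "row_op T" column
proof -
  interpret contraction_adjoint_pair "dsum S" S column_adj column
    by (rule column_adj_pair)
  have "clinear_on (dsum S) S (row_op T)"
    using lin by (simp add: clinear_on_def row_op_has_sum(2) image_subset_iff
        csubspace_add[OF dsum_subspace] csubspace_scaleC[OF dsum_subspace])
  then show "contraction_adjoint_pair (dsum S) S (row_op T) column"
    by unfold_locales
      (auto simp: row_op_has_sum(2) adjoint intro: subspace dsum_subspace column_clinear norm_column_le)
qed

lemma adj_on_row_op: "y \<in> S \<Longrightarrow> adj_on (dsum S) S (row_op T) y = column y"
  by (rule adj_on_eqI[OF dsum_subspace clinear_on_in[OF column_clinear]]) (auto simp: row.adjoint)

lemma defect_on_eq:
  "f \<in> dsum S \<Longrightarrow> defect_on S T f = sqrt_series (\<lambda>f. column (row_op T f)) f"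
  unfolding defect_on_def
  by (rule row.initial.opsqrt_on_eq_series)
    (simp_all add: adj_on_row_op clinear_on_in[OF row.lin])

lemma defect_star_on_eq:
  "h \<in> S \<Longrightarrow> defect_star_on S T h = sqrt_series (\<lambda>h. row_op T (column h)) h"
  unfolding defect_star_on_def
  by (rule row.final.opsqrt_on_eq_series) (simp_all add: adj_on_eq row_op_def column_nth)

lemma defect_on_square:
  "f \<in> dsum S \<Longrightarrow> defect_on S T (defect_on S T f) = f - column (row_op T f)"
  by (simp add: defect_on_eq row.initial.series_in row.initial.series_square)

lemma defect_on_zero: "defect_on S T 0 = 0"
  using clinear_on_zero[OF row.initial.series_clinear] csubspace_zero[OF dsum_subspace]
  by (simp add: defect_on_eq)

lemma defect_star_on_clinear: "clinear_on S S (defect_star_on S T)"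
  using row.final.series_clinear
  by (simp add: clinear_on_def defect_star_on_eq csubspace_add[OF subspace] csubspace_scaleC[OF subspace])

lemma row_op_defect_on:
  "f \<in> dsum S \<Longrightarrow> row_op T (defect_on S T f) = defect_star_on S T (row_op T f)"
  by (simp add: defect_on_eq defect_star_on_eq clinear_on_in[OF row.lin] row.series_intertwine_pair)

lemma cinner_defect_star_on:
  assumes h: "h \<in> S"
  shows "cinner (defect_star_on S T h) (defect_star_on S T h) = cinner h (h - row_op T (column h))"
  using positive_on_selfadjoint[OF subspace row.final.series_positive h row.final.series_in[OF h]]
  by (simp add: defect_star_on_eq h row.final.series_square)

text \<open>On the kernel of the row operator all positive powers in the series vanish, which leaves
  the constant term 1.\<close>

lemma defect_on_kernel:
  assumes f: "f \<in> dsum S" and kernel: "row_op T f = 0"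
  shows "defect_on S T f = f"
proof -
  let ?X = "\<lambda>f. column (row_op T f)"
  have "column 0 = 0"
    using clinear_on_zero[OF column_clinear] csubspace_zero[OF subspace] by simp
  then have X: "?X f = 0" "?X 0 = 0"
    using row_op_has_sum(2)[of 0] clinear_on_zero[OF row.lin] csubspace_zero[OF dsum_subspace]
    by (simp_all add: kernel)
  have "(?X ^^ n) 0 = 0" for n
    by (induction n) (simp_all add: X)
  then have "(?X ^^ n) f = 0" if "n > 0" for n
    using that by (auto simp: gr0_conv_Suc funpow_Suc_right X simp del: funpow.simps)
  then have "sqrt_series ?X f = (\<Sum>\<^sub>\<infinity>n\<in>{0}. sqrt_coeff n *\<^sub>R (?X ^^ n) f)"
    unfolding sqrt_series_def by (intro infsum_cong_neutral) auto
  then show ?thesis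
    by (simp add: defect_on_eq f)
qed

lemma cinner_defect_on:
  assumes "f \<in> dsum S" "g \<in> dsum S"
  shows "cinner (defect_on S T f) g = cinner f (defect_on S T g)"
  using positive_on_selfadjoint[OF dsum_subspace row.initial.series_positive assms]
  by (simp add: defect_on_eq assms)

text \<open>Taking adjoints reverses a product, so the adjoint belonging to the first letter acts
  first.\<close>

primrec adj_word :: "'i list \<Rightarrow> 'a \<Rightarrow> 'a" where
  "adj_word [] = id"
| "adj_word (i # \<alpha>) = adj_word \<alpha> \<circ> Ts i"

lemma adj_word_in: "y \<in> S \<Longrightarrow> adj_word \<alpha> y \<in> S"
  by (induction \<alpha> arbitrary: y) (simp_all add: adj_in)

lemma word_op_in: "x \<in> S \<Longrightarrow> word_op T \<alpha> x \<in> S"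
  by (induction \<alpha>) (simp_all add: clinear_on_in[OF lin])

lemma adj_on_word_op:
  assumes y: "y \<in> S"
  shows "adj_on S S (word_op T \<alpha>) y = adj_word \<alpha> y"
proof -
  have "cinner (adj_word \<alpha> y) x = cinner y (word_op T \<alpha> x)" if "x \<in> S" for x
    using y by (induction \<alpha> arbitrary: y) (simp_all add: adj_in adjoint word_op_in that)
  then show ?thesis
    by (intro adj_on_eqI[OF subspace] adj_word_in y)
qed

end

section \<open>Extension of isometries to the closure\<close>

text \<open>Equality of norms makes \<open>G h\<close> depend on \<open>D h\<close> alone and turns
  Cauchy sequences of values of \<open>D\<close> into Cauchy sequences of values of
  \<open>G\<close>, so the map extends by limits.\<close>

lemma isometric_extension:
  fixes D :: "'c::complex_inner \<Rightarrow> 'a::complex_inner" and G :: "'c \<Rightarrow> 'b::chilbert_space"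
  assumes S: "closed_csubspace S" and L: "closed_csubspace L"
    and D: "clinear_on S UNIV D" and G: "clinear_on S L G"
    and norm_eq: "\<And>h. h \<in> S \<Longrightarrow> norm (G h) = norm (D h)"
  shows "\<exists>!g. g \<in> extensional (closure (D ` S)) \<and> isometry_on (closure (D ` S)) L g
    \<and> (\<forall>h\<in>S. g (D h) = G h)"
proof -
  define M where "M = closure (D ` S)"
  \<comment> \<open>The closure of the graph of the map from \<open>D h\<close> to
    \<open>G h\<close>, described by sequences.\<close>
  define rel where "rel x y \<longleftrightarrow> (\<exists>h. (\<forall>n. h n \<in> S) \<and> (\<lambda>n. D (h n)) \<longlonglongrightarrow> x \<and> (\<lambda>n. G (h n)) \<longlonglongrightarrow> y)"
    for x y
  have norm_diff_eq: "norm (G h - G k) = norm (D h - D k)" if "h \<in> S" "k \<in> S" for h k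
    using norm_eq[OF csubspace_diff[OF S that]]
    by (simp add: clinear_on_diff[OF D S that] clinear_on_diff[OF G S that])
  have rel_D: "rel (D h) (G h)" if "h \<in> S" for h
    unfolding rel_def using that by (intro exI[of _ "\<lambda>_. h"]) simp
  have rel_add: "rel (x + x') (y + y')" if "rel x y" "rel x' y'" for x x' y y'
  proof -
    from that obtain h h' where h: "\<And>n. h n \<in> S" "(\<lambda>n. D (h n)) \<longlonglongrightarrow> x" "(\<lambda>n. G (h n)) \<longlonglongrightarrow> y"
      and h': "\<And>n. h' n \<in> S" "(\<lambda>n. D (h' n)) \<longlonglongrightarrow> x'" "(\<lambda>n. G (h' n)) \<longlonglongrightarrow> y'"
      unfolding rel_def by metis
    then show ?thesis
      unfolding rel_def
      by (intro exI[of _ "\<lambda>n. h n + h' n"])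
        (simp add: csubspace_add[OF S] clinear_on_add[OF D] clinear_on_add[OF G] tendsto_add)
  qed
  have rel_scaleC: "rel (c *\<^sub>C x) (c *\<^sub>C y)" if xy: "rel x y" for c x y
  proof -
    from xy obtain h where h: "\<And>n. h n \<in> S" "(\<lambda>n. D (h n)) \<longlonglongrightarrow> x" "(\<lambda>n. G (h n)) \<longlonglongrightarrow> y"
      unfolding rel_def by metis
    then show ?thesis
      unfolding rel_def
      by (intro exI[of _ "\<lambda>n. c *\<^sub>C h n"])
        (simp add: csubspace_scaleC[OF S] clinear_on_scaleC[OF D] clinear_on_scaleC[OF G]
          bounded_linear.tendsto[OF bounded_linear_scaleC])
  qed
  have rel_norm: "norm y = norm x" if xy: "rel x y" for x y
  proof -
    from xy obtain h where h: "\<And>n. h n \<in> S" "(\<lambda>n. D (h n)) \<longlonglongrightarrow> x" "(\<lambda>n. G (h n)) \<longlonglongrightarrow> y"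
      unfolding rel_def by metis
    then have "(\<lambda>n. norm (D (h n))) \<longlonglongrightarrow> norm y"
      using tendsto_norm[OF h(3)] by (simp add: norm_eq)
    then show ?thesis
      using tendsto_norm[OF h(2)] LIMSEQ_unique by blast
  qed
  \<comment> \<open>By linearity \<open>y - y'\<close> is related to 0, and related vectors have
    equal norms.\<close>
  have rel_unique: "y = y'" if "rel x y" "rel x y'" for x y y'
    using rel_norm[OF rel_add[OF that(1) rel_scaleC[OF that(2), of "-1"]]]
    by (simp add: scaleC_minus1)
  have rel_L: "y \<in> L" if xy: "rel x y" for x y
    using xy closed_sequentially[OF csubspace_closed[OF L], of _ y] clinear_on_in[OF G]
    unfolding rel_def by metis
  have rel_ex: "\<exists>y. rel x y" if x: "x \<in> M" for x
  proof -
    obtain f where f: "\<And>n. f n \<in> D ` S" and lim: "f \<longlonglongrightarrow> x"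
      using x unfolding M_def closure_sequential by auto
    have "\<exists>h. h \<in> S \<and> f n = D h" for n
      using f[of n] by blast
    then obtain h where hS: "\<And>n. h n \<in> S" and "\<And>n. f n = D (h n)"
      by metis
    then have "f = (\<lambda>n. D (h n))"
      by blast
    with lim hS have h: "\<And>n. h n \<in> S" "(\<lambda>n. D (h n)) \<longlonglongrightarrow> x"
      by simp_all
    have "Cauchy (\<lambda>n. D (h n))"
      using h(2) by (rule LIMSEQ_imp_Cauchy)
    then have "Cauchy (\<lambda>n. G (h n))"
      by (simp add: Cauchy_def dist_norm norm_diff_eq h(1))
    then show ?thesis
      using h unfolding rel_def by (auto simp: Cauchy_convergent_iff convergent_def)
  qed
  have rel_M: "x \<in> M" if xy: "rel x y" for x y
    using xy unfolding rel_def M_def closure_sequential by fast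
  define g where "g = restrict (\<lambda>x. THE y. rel x y) M"
  have rel_g: "rel x (g x)" if "x \<in> M" for x
  proof -
    have "\<exists>!y. rel x y"
      using rel_ex[OF that] rel_unique by blast
    then show ?thesis
      using theI' that by (simp add: g_def)
  qed
  have g_eqI: "g x = y" if "rel x y" for x y
    using rel_unique[OF rel_g[OF rel_M[OF that]] that] .
  show ?thesis
    unfolding M_def[symmetric]
  proof (rule ex1I[of _ g], intro conjI ballI)
    show "g \<in> extensional M"
      by (simp add: g_def)
    show "isometry_on M L g"
      unfolding isometry_on_def
      by (auto intro!: clinear_onI rel_L[OF rel_g] g_eqI rel_add rel_scaleC rel_g rel_norm)
    show "g (D h) = G h" if "h \<in> S" for h
      by (rule g_eqI[OF rel_D[OF that]])
  next
    fix k
    assume k: "k \<in> extensional M \<and> isometry_on M L k \<and> (\<forall>h\<in>S. k (D h) = G h)"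
    then have lin_k: "clinear_on M L k" and norm_k: "\<And>x. x \<in> M \<Longrightarrow> norm (k x) = norm x"
      by (auto simp: isometry_on_def)
    have "k x = g x" if x: "x \<in> M" for x
    proof -
      obtain h where h: "\<And>n. h n \<in> S" "(\<lambda>n. D (h n)) \<longlonglongrightarrow> x" "(\<lambda>n. G (h n)) \<longlonglongrightarrow> g x"
        using rel_g[OF x] unfolding rel_def by metis
      have DM: "D (h n) \<in> M" and DM': "(- 1) *\<^sub>C x \<in> M" for n
        using rel_M[OF rel_D[OF h(1)]] rel_M[OF rel_scaleC[OF rel_g[OF x]]] by auto
      \<comment> \<open>A competitor \<open>k\<close> is isometric at \<open>D (h n) - x\<close>,
        which forces \<open>k x\<close> to be the limit of \<open>G (h n)\<close>.\<close>
      have "norm (G (h n) - k x) = norm (D (h n) - x)" for n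
      proof -
        have "D (h n) + (- 1) *\<^sub>C x \<in> M"
          by (rule rel_M[OF rel_add[OF rel_D[OF h(1)] rel_scaleC[OF rel_g[OF x]]]])
        from norm_k[OF this]
        have "norm (k (D (h n)) + (- 1) *\<^sub>C k x) = norm (D (h n) + (- 1) *\<^sub>C x)"
          by (simp only: clinear_on_add[OF lin_k DM DM'] clinear_on_scaleC[OF lin_k x])
        then show ?thesis
          using k h(1) by (simp add: scaleC_minus1)
      qed
      moreover have "(\<lambda>n. norm (D (h n) - x)) \<longlonglongrightarrow> 0"
        using h(2) by (intro tendsto_norm_zero LIM_zero)
      ultimately have "(\<lambda>n. norm (G (h n) - k x)) \<longlonglongrightarrow> 0"
        by simp
      from LIM_zero_cancel[OF tendsto_norm_zero_cancel[OF this]]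
      have "(\<lambda>n. G (h n)) \<longlonglongrightarrow> k x" .
      with h(3) show ?thesis
        using LIMSEQ_unique by blast
    qed
    with k show "k = g"
      by (intro extensionalityI[of k M g]) (simp_all add: g_def)
  qed
qed

text \<open>Polarisation, with \<open>- \<i>\<close> giving the imaginary part. \<open>S\<close>
  enters through its algebraic closure properties, which are what is checked for the domain of
  \<open>W\<close>.\<close>

lemma isometry_on_cinner:
  assumes f: "isometry_on S T f"
    and S: "\<And>x y. x \<in> S \<Longrightarrow> y \<in> S \<Longrightarrow> x + y \<in> S" "\<And>c x. x \<in> S \<Longrightarrow> c *\<^sub>C x \<in> S"
    and xy: "x \<in> S" "y \<in> S"
  shows "cinner (f x) (f y) = cinner x y"
proof -
  have lin: "clinear_on S T f" and norm: "\<And>x. x \<in> S \<Longrightarrow> norm (f x) = norm x"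
    using f by (auto simp: isometry_on_def)
  have Re_eq: "Re (cinner (f x) (f z)) = Re (cinner x z)" if z: "z \<in> S" for z
    using norm_add_power2[of "f x" "f z"] norm_add_power2[of x z] norm[OF S(1)[OF xy(1) z]]
    by (simp add: clinear_on_add[OF lin xy(1) z] norm xy z)
  have "Re (cinner (f x) (f ((- \<i>) *\<^sub>C y))) = Re (cinner x ((- \<i>) *\<^sub>C y))"
    by (intro Re_eq S xy)
  then show ?thesis
    using Re_eq[OF xy(2)]
    by (simp only: clinear_on_scaleC[OF lin xy(2)] cinner_scaleC_right) (simp add: complex_eq_iff)
qed

section \<open>Coisometric tuples with a common eigenvector of the adjoints\<close>

locale coisometric_eigenvector =
  fixes A :: "'i \<Rightarrow> 'h::chilbert_space \<Rightarrow> 'h" and \<Omega> :: 'h and \<omega> :: "'i \<Rightarrow> complex"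
  assumes A_bounded: "bounded_clinear_on UNIV UNIV (A i)"
    and A_coisometric: "coisometric A"
    and Omega_unit: "norm \<Omega> = 1"
    and omega_unit: "((\<lambda>i. (cmod (\<omega> i))\<^sup>2) has_sum 1) UNIV"
    and eigen: "adj (A i) \<Omega> = cnj (\<omega> i) *\<^sub>C \<Omega>"
begin

abbreviation "H \<equiv> H_ring \<Omega>"
abbreviation "Ad i \<equiv> adj (A i)"

text \<open>\<open>A i\<close> leaves the complement of \<open>\<Omega>\<close> invariant, but its
  adjoint need not; the adjoint of the restriction is therefore the compression of
  \<open>Ad i\<close>.\<close>

definition ring_adj :: "'i \<Rightarrow> 'h \<Rightarrow> 'h" where
  "ring_adj i h = Ad i h - cinner \<Omega> (Ad i h) *\<^sub>C \<Omega>"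

lemma A_clinear: "clinear_on UNIV UNIV (A i)"
  using A_bounded by (simp add: bounded_clinear_on_def)

lemma cinner_Ad: "cinner (Ad i y) x = cinner y (A i x)"
  by (rule cinner_adj_on[OF closed_csubspace_UNIV A_bounded]) simp

lemma cinner_Ad': "cinner x (Ad i y) = cinner (A i x) y"
  by (subst cinner_commute, subst (2) cinner_commute) (simp add: cinner_Ad)

lemma cinner_Omega: "cinner \<Omega> \<Omega> = 1"
  by (simp add: cinner_self Omega_unit)

lemma has_sum_Ad: "((\<lambda>i. A i (Ad i h)) has_sum h) UNIV"
  using A_coisometric by (simp add: coisometric_def)

lemma has_sum_norm_Ad: "((\<lambda>i. (norm (Ad i h))\<^sup>2) has_sum (norm h)\<^sup>2) UNIV"
proof -
  have "((\<lambda>i. cinner h (A i (Ad i h))) has_sum cinner h h) UNIV"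
    by (rule has_sum_cinner_right[OF has_sum_Ad])
  then show ?thesis
    by (simp only: cinner_Ad[symmetric] cinner_self has_sum_of_real_iff)
qed

sublocale full: row_contraction UNIV A Ad
  by standard
    (auto intro: A_clinear finite_sum_le_has_sum[OF has_sum_norm_Ad] simp: cinner_Ad)

sublocale scalar: row_contraction UNIV "\<lambda>i z. \<omega> i * z" "\<lambda>i z. cnj (\<omega> i) * z"
proof
  show "clinear_on UNIV UNIV (\<lambda>z. \<omega> i * z)" for i
    by (rule clinear_onI) (simp_all add: scaleC_complex_def algebra_simps)
  show "(\<Sum>i\<in>F. (norm (cnj (\<omega> i) * z))\<^sup>2) \<le> (norm z)\<^sup>2" if "finite F" for F z
    using finite_sum_le_has_sum[OF omega_unit that, THEN mult_right_mono, of "(norm z)\<^sup>2"]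
    by (simp add: norm_mult power_mult_distrib flip: sum_distrib_right)
qed (simp_all add: cinner_complex_def)

lemma H_subspace: "closed_csubspace H"
  unfolding H_ring_def by (rule closed_csubspace_orthogonal)

lemma H_iff: "h \<in> H \<longleftrightarrow> cinner \<Omega> h = 0"
  by (simp add: H_ring_def)

text \<open>Moving \<open>A i\<close> to the left meets the eigenvector \<open>\<Omega>\<close> of
  the adjoint and produces a multiple of \<open>cinner \<Omega> h\<close>.\<close>

lemma A_in_H: "h \<in> H \<Longrightarrow> A i h \<in> H"
  by (simp add: H_iff eigen cinner_scaleC_left flip: cinner_Ad)

lemma ring_adj_in: "ring_adj i h \<in> H"
  by (simp add: H_iff ring_adj_def cinner_diff_right cinner_scaleC_right cinner_Omega)

lemma Ad_decomp: "Ad i h = ring_adj i h + cinner \<Omega> (Ad i h) *\<^sub>C \<Omega>"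
  by (simp add: ring_adj_def)

text \<open>Pythagoras for the splitting of \<open>Ad i h\<close> along \<open>\<Omega>\<close>. For
  \<open>h\<close> in \<open>H\<close> the second summand becomes the squared modulus of a
  coordinate of \<open>Dh h\<close>.\<close>

lemma norm_Ad_power2: "(norm (Ad i h))\<^sup>2 = (norm (ring_adj i h))\<^sup>2 + (cmod (cinner \<Omega> (Ad i h)))\<^sup>2"
proof -
  have "cinner (ring_adj i h) \<Omega> = 0"
    using ring_adj_in[of i h] by (subst cinner_commute) (simp add: H_iff)
  then show ?thesis
    by (subst Ad_decomp)
      (simp add: norm_add_power2 cinner_scaleC_right norm_scaleC Omega_unit)
qed

sublocale ring: row_contraction H "A_ring A \<Omega>" ring_adj
proof
  show "clinear_on H H (A_ring A \<Omega> i)" for i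
    by (rule clinear_onI)
      (simp_all add: A_ring_def A_in_H csubspace_add[OF H_subspace] csubspace_scaleC[OF H_subspace]
        clinear_on_add[OF A_clinear] clinear_on_scaleC[OF A_clinear])
  show "cinner (ring_adj i y) x = cinner y (A_ring A \<Omega> i x)" if "x \<in> H" for i x y
    using that by (simp add: ring_adj_def A_ring_def cinner_diff_left cinner_scaleC_left cinner_Ad H_iff)
  show "(\<Sum>i\<in>F. (norm (ring_adj i y))\<^sup>2) \<le> (norm y)\<^sup>2" if "finite F" for F y
  proof -
    have "(\<Sum>i\<in>F. (norm (ring_adj i y))\<^sup>2) \<le> (\<Sum>i\<in>F. (norm (Ad i y))\<^sup>2)"
      by (rule sum_mono) (simp add: norm_Ad_power2)
    also have "\<dots> \<le> (norm y)\<^sup>2"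
      using that by (intro finite_sum_le_has_sum[OF has_sum_norm_Ad]) auto
    finally show ?thesis .
  qed
qed (simp_all add: H_subspace ring_adj_in)

section \<open>The vacuum coefficients and the isometry \<open>gamma_iso\<close>\<close>

abbreviation "DS \<equiv> D_ring_star A \<Omega>"
abbreviation "Dh \<equiv> D_hat_star A \<Omega> \<omega>"

lemma DS_eq: "DS = defect_star_on H (A_ring A \<Omega>)"
  by (simp add: D_ring_star_def)

lemma Domega_subspace: "closed_csubspace (Domega_space \<omega>)"
  unfolding Domega_space_def by (rule closed_csubspace_orthogonal)

lemma cinner_ell: "h \<in> H \<Longrightarrow> cinner (ell A \<Omega> \<omega> i) h = cinner \<Omega> (Ad i h)"
  by (simp add: ell_def cinner_diff_left cinner_scaleC_left H_iff cinner_Ad')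

lemma D_hat_star_nth:
  assumes h: "h \<in> H"
  shows "ell2_nth (Dh h) i = cinner \<Omega> (Ad i h)"
proof -
  let ?v = "Abs_ell2 (\<lambda>i. cinner \<Omega> (Ad i h))"
  have "is_ell2 (\<lambda>i. Ad i h)"
    using has_sum_norm_Ad[of h] by (auto simp: is_ell2_def summable_on_def)
  then have "is_ell2 (\<lambda>i. cinner \<Omega> (Ad i h))"
  proof (rule is_ell2_mono)
    show "norm (cinner \<Omega> (Ad i h)) \<le> norm (Ad i h)" for i
      using complex_inner_Cauchy_Schwarz[of \<Omega> "Ad i h"] by (simp add: Omega_unit)
  qed
  then have nth: "ell2_nth ?v i = cinner \<Omega> (Ad i h)" for i
    by (rule Abs_ell2_nth)
  have "c *\<^sub>C ell2_single i 1 = ell2_single i c" for i :: 'i and c :: complex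
    by (rule ell2_eqI) (simp add: scaleC_complex_def)
  then have "Dh h = ?v"
    unfolding D_hat_star_def using ell2_has_sum_single[of ?v] h
    by (intro infsumI) (simp add: nth cinner_ell)
  then show ?thesis
    by (simp add: nth)
qed

lemma omega_cnj_nth: "ell2_nth (Abs_ell2 (\<lambda>i. cnj (\<omega> i))) i = cnj (\<omega> i)"
proof (rule Abs_ell2_nth)
  show "is_ell2 (\<lambda>i. cnj (\<omega> i))"
    using omega_unit by (auto simp: is_ell2_def summable_on_def)
qed

text \<open>Pairing the coisometry relation for \<open>h\<close> with \<open>\<Omega>\<close> gives
  \<open>cinner \<Omega> h\<close>, which is 0, as the sum of the terms
  \<open>\<omega> i * cinner \<Omega> (Ad i h)\<close>.\<close>

lemma D_hat_star_in:
  assumes h: "h \<in> H"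
  shows "Dh h \<in> Domega_space \<omega>"
proof -
  have "((\<lambda>i. cinner \<Omega> (A i (Ad i h))) has_sum cinner \<Omega> h) UNIV"
    by (rule has_sum_cinner_right[OF has_sum_Ad])
  then have "((\<lambda>i. \<omega> i * cinner \<Omega> (Ad i h)) has_sum 0) UNIV"
    using h by (simp add: eigen cinner_scaleC_left H_iff flip: cinner_Ad)
  then show ?thesis
    by (simp add: Domega_space_def cinner_ell2_def omega_cnj_nth D_hat_star_nth[OF h]
        cinner_complex_def infsumI)
qed

lemma D_hat_star_clinear: "clinear_on H (Domega_space \<omega>) Dh"
  by (intro clinear_onI ell2_eqI)
    (simp_all add: D_hat_star_in D_hat_star_nth csubspace_add[OF H_subspace]
      csubspace_scaleC[OF H_subspace] clinear_on_add[OF full.adj_clinear]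
      clinear_on_scaleC[OF full.adj_clinear] cinner_add_right cinner_scaleC_right scaleC_complex_def)

text \<open>The squared norm of \<open>DS h\<close> is that of \<open>h\<close> minus that of the
  restricted column. By coisometry the former is the sum of all \<open>(norm (Ad i h))^2\<close>, so
  exactly the \<open>\<Omega>\<close> parts remain.\<close>

lemma norm_D_hat_star:
  assumes h: "h \<in> H"
  shows "norm (Dh h) = norm (DS h)"
proof -
  let ?c = "ring.column h"
  have "complex_of_real ((norm (DS h))\<^sup>2) = cinner h h - cinner h (row_op (A_ring A \<Omega>) ?c)"
    by (simp only: cinner_self[symmetric] DS_eq ring.cinner_defect_star_on[OF h] cinner_diff_right)
  also have "\<dots> = complex_of_real ((norm h)\<^sup>2 - (norm ?c)\<^sup>2)"
    using ring.row.adjoint[of ?c h] h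
    by (simp add: clinear_on_in[OF ring.column_clinear] cinner_self)
  finally have DS: "(norm (DS h))\<^sup>2 = (norm h)\<^sup>2 - (norm ?c)\<^sup>2"
    by (simp only: of_real_eq_iff)
  have "((\<lambda>i. (norm (Ad i h))\<^sup>2 + - (norm (ell2_nth ?c i))\<^sup>2) has_sum (norm (DS h))\<^sup>2) UNIV"
    unfolding DS diff_conv_add_uminus by (intro has_sum_add has_sum_norm_Ad has_sum_uminusI has_sum_norm_ell2)
  moreover have "(norm (Ad i h))\<^sup>2 + - (norm (ell2_nth ?c i))\<^sup>2 = (norm (ell2_nth (Dh h) i))\<^sup>2" for i
    by (simp add: norm_Ad_power2 ring.column_nth h D_hat_star_nth)
  ultimately have "(norm (Dh h))\<^sup>2 = (norm (DS h))\<^sup>2"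
    using has_sum_norm_ell2[of "Dh h"] by (simp add: has_sum_unique)
  then show ?thesis
    by simp
qed

text \<open>\<open>isometric_extension\<close> settles the definite description, with
  \<open>norm_D_hat_star\<close> as its norm condition.\<close>

lemma gamma_iso_eq:
  assumes "h \<in> H"
  shows "gamma_iso A \<Omega> \<omega> (DS h) = Dh h"
proof -
  have "clinear_on H UNIV DS"
    using ring.defect_star_on_clinear by (auto simp: DS_eq clinear_on_def)
  from theI'[OF isometric_extension[OF H_subspace Domega_subspace this D_hat_star_clinear norm_D_hat_star]]
  show ?thesis
    using assms unfolding gamma_iso_def D_hat_star_def D_ring_star_space_def by auto
qed

lemma DS_clinear: "clinear_on H H DS"
  using ring.defect_star_on_clinear by (simp add: DS_eq)

lemma adj_word_clinear: "clinear_on H H (ring.adj_word \<alpha>)"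
proof (induction \<alpha>)
  case (Cons i \<alpha>)
  then show ?case
    using ring.adj_clinear[of i] by (auto simp: clinear_on_def image_subset_iff)
qed (simp add: clinear_on_def)

lemma D_hat_star_word_clinear: "clinear_on H (Domega_space \<omega>) (\<lambda>h. Dh (ring.adj_word \<alpha> h))"
  using D_hat_star_clinear adj_word_clinear[of \<alpha>] by (auto simp: clinear_on_def image_subset_iff)

end

section \<open>The intertwining unitary\<close>

locale intertwined_tuple = coisometric_eigenvector A \<Omega> \<omega>
  for A :: "'i \<Rightarrow> 'h::chilbert_space \<Rightarrow> 'h" and \<Omega> and \<omega> :: "'i \<Rightarrow> complex" +
  fixes W :: "'h \<times> ('i, ('i, 'h) ell2) fock \<Rightarrow> complex \<times> ('i, ('i, complex) ell2) fock"
  assumes W: "intertwining_unitary A \<Omega> \<omega> W"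
begin

abbreviation V where "V i \<equiv> dilation A i"
abbreviation Vt where "Vt i \<equiv> dilation (\<lambda>j z. \<omega> j * z) i"

definition dom :: "('h \<times> ('i, ('i, 'h) ell2) fock) set" where
  "dom = UNIV \<times> dsum (DA_space A)"

definition cod :: "(complex \<times> ('i, ('i, complex) ell2) fock) set" where
  "cod = UNIV \<times> dsum (Domega_space \<omega>)"

definition \<xi> :: "'h \<Rightarrow> ('i, ('i, complex) ell2) fock" where
  "\<xi> h = snd (W (h, 0))"

lemma DA_space:
  shows DA_zero: "0 \<in> DA_space A"
    and DA_add: "x \<in> DA_space A \<Longrightarrow> y \<in> DA_space A \<Longrightarrow> x + y \<in> DA_space A"
    and DA_scaleC: "x \<in> DA_space A \<Longrightarrow> c *\<^sub>C x \<in> DA_space A"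
proof -
  have lin: "clinear_on UNIV UNIV (defect_on UNIV A)"
    using full.row.initial.series_clinear by (simp add: clinear_on_def full.defect_on_eq)
  show "0 \<in> DA_space A"
    unfolding DA_space_def by (rule range_eqI[of _ _ 0]) (simp add: full.defect_on_zero)
  show "x + y \<in> DA_space A" if "x \<in> DA_space A" "y \<in> DA_space A"
    using that unfolding DA_space_def by (auto simp flip: clinear_on_add[OF lin])
  show "c *\<^sub>C x \<in> DA_space A" if "x \<in> DA_space A"
    using that unfolding DA_space_def by (auto simp flip: clinear_on_scaleC[OF lin])
qed

lemma dom_add: "x \<in> dom \<Longrightarrow> y \<in> dom \<Longrightarrow> x + y \<in> dom"
  and dom_scaleC: "x \<in> dom \<Longrightarrow> c *\<^sub>C x \<in> dom"
  by (auto simp: dom_def dsum_iff DA_add DA_scaleC scaleC_prod_def)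

lemma base_in_dom: "(h, 0) \<in> dom"
  by (simp add: dom_def dsum_iff DA_zero)

lemma V_in_dom: "x \<in> dom \<Longrightarrow> V i x \<in> dom"
  by (cases x) (auto simp: dom_def dsum_iff dilation_def DA_zero DA_space_def[of A] ell2_nth_creation
      split: list.split intro: DA_zero[unfolded DA_space_def])

lemma W_isometry: "isometry_on dom cod W"
  and W_surj: "W ` dom = cod"
  and W_V: "x \<in> dom \<Longrightarrow> W (V i x) = Vt i (W x)"
  and W_Omega: "W (\<Omega>, 0) = (1, 0)"
  using W by (auto simp: intertwining_unitary_def unitary_on_def dom_def cod_def)

lemma W_clinear: "clinear_on dom cod W"
  using W_isometry by (simp add: isometry_on_def)

lemma cinner_W: "x \<in> dom \<Longrightarrow> y \<in> dom \<Longrightarrow> cinner (W x) (W y) = cinner x y"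
  by (rule isometry_on_cinner[OF W_isometry dom_add dom_scaleC])

text \<open>The adjoint of \<open>V\<^sub>i\<close> restricts to \<open>A\<^sub>i\<^sup>*\<close> on \<open>\<H>\<close>, and \<open>W\<close> transports this to \<open>Vt i\<close>.\<close>

lemma cinner_W_Vt:
  assumes y: "y \<in> cod"
  shows "cinner (W (h, 0)) (Vt i y) = cinner (W (Ad i h, 0)) y"
proof -
  from y have "y \<in> W ` dom"
    by (simp only: W_surj)
  then obtain x where x: "y = W x" "x \<in> dom"
    by (rule imageE)
  have "cinner (W (h, 0)) (Vt i y) = cinner (h, 0) (V i x)"
    by (simp add: x W_V[symmetric] cinner_W base_in_dom V_in_dom)
  also have "\<dots> = cinner (Ad i h, 0) x"
    by (cases x) (simp add: dilation_def cinner_prod_def cinner_Ad)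
  also have "\<dots> = cinner (W (Ad i h, 0)) y"
    by (simp add: x cinner_W base_in_dom)
  finally show ?thesis .
qed

lemma W_base: "W (h, 0) = (cinner \<Omega> h, \<xi> h)"
proof (rule prod_eqI)
  \<comment> \<open>The scalar component is read off by pairing with \<open>(1, 0)\<close>, the
    image of \<open>\<Omega>\<close>.\<close>
  have "fst (W (h, 0)) = cinner (W (\<Omega>, 0)) (W (h, 0))"
    by (simp add: W_Omega cinner_prod_def cinner_complex_def)
  also have "\<dots> = cinner \<Omega> h"
    by (simp only: cinner_W base_in_dom) (simp add: cinner_prod_def)
  finally show "fst (W (h, 0)) = fst (cinner \<Omega> h, \<xi> h)"
    by simp
qed (simp add: \<xi>_def)

lemma xi_in: "ell2_nth (\<xi> h) \<alpha> \<in> Domega_space \<omega>"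
  using clinear_on_in[OF W_clinear base_in_dom[of h]] by (simp add: cod_def W_base dsum_iff)

text \<open>The image of \<open>\<Omega>\<close> has no Fock part. Hence \<open>Ad i h\<close> may
  be replaced by \<open>ring_adj i h\<close> inside \<open>\<xi>\<close>.\<close>

lemma xi_add_Omega: "\<xi> (h + c *\<^sub>C \<Omega>) = \<xi> h"
proof -
  have "(h + c *\<^sub>C \<Omega>, 0) = (h, 0) + c *\<^sub>C (\<Omega>, 0 :: ('i, ('i, 'h) ell2) fock)"
    by (simp add: scaleC_prod_def)
  then have "W (h + c *\<^sub>C \<Omega>, 0) = W (h, 0) + c *\<^sub>C W (\<Omega>, 0)"
    by (simp only: clinear_on_add[OF W_clinear] clinear_on_scaleC[OF W_clinear] base_in_dom dom_scaleC)
  then show ?thesis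
    by (simp add: \<xi>_def W_Omega scaleC_prod_def)
qed

lemma creation_single: "creation i (ell2_single \<beta> x) = ell2_single (i # \<beta>) x"
  by (rule ell2_eqI) (auto simp: ell2_nth_creation split: list.split)

lemma creation_zero: "creation i 0 = 0"
  by (rule ell2_eqI) (simp add: ell2_nth_creation split: list.split)

text \<open>\<open>Vt i\<close> shifts an entry at \<open>\<beta>\<close> to
  \<open>i # \<beta>\<close>. Test vectors with scalar part 0 suppress its vacuum term, and tests
  from \<open>Domega_space \<omega>\<close> suffice because both components lie there.\<close>

lemma xi_Cons: "ell2_nth (\<xi> h) (i # \<beta>) = ell2_nth (\<xi> (Ad i h)) \<beta>"
proof (rule csubspace_eqI[OF Domega_subspace xi_in xi_in])
  fix x assume x: "x \<in> Domega_space \<omega>"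
  have y: "(0, ell2_single \<beta> x) \<in> cod"
    by (simp add: cod_def ell2_single_in_dsum Domega_subspace x)
  show "cinner (ell2_nth (\<xi> h) (i # \<beta>)) x = cinner (ell2_nth (\<xi> (Ad i h)) \<beta>) x"
    using cinner_W_Vt[OF y, of h i]
    by (simp add: W_base dilation_def cinner_prod_def scalar.defect_on_zero creation_single
        cinner_ell2_single_right)
qed

text \<open>\<open>Domega_space \<omega>\<close> is the kernel of the row \<open>\<omega>\<close>:
  its defining inner product is the sum of \<open>\<omega> i\<close> times the coordinates.\<close>

lemma scalar_defect_fixes:
  assumes "x \<in> Domega_space \<omega>"
  shows "defect_on UNIV (\<lambda>i z. \<omega> i * z) x = x"
  using assms
  by (intro scalar.defect_on_kernel)
    (simp_all add: row_op_def Domega_space_def cinner_ell2_def omega_cnj_nth cinner_complex_def)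

text \<open>Tested on \<open>(1, 0)\<close>, \<open>Vt i\<close> yields \<open>\<omega> i\<close>
  and the defect of a basis vector at the vacuum. The scalar term drops out as \<open>h\<close> is
  orthogonal to \<open>\<Omega>\<close>, and the selfadjoint defect moves onto
  \<open>\<xi> h\<close>, whose entries it fixes.\<close>

lemma xi_Nil:
  assumes h: "h \<in> H"
  shows "ell2_nth (\<xi> h) [] = Dh h"
proof (rule ell2_eqI)
  fix i
  have y: "(1, 0) \<in> cod"
    using clinear_on_in[OF W_clinear base_in_dom[of \<Omega>]] by (simp add: W_Omega)
  have "cinner (ell2_nth (\<xi> h) []) (ell2_single i 1)
      = cinner (ell2_nth (\<xi> h) []) (defect_on UNIV (\<lambda>i z. \<omega> i * z) (ell2_single i 1))"
    using scalar.cinner_defect_on[of "ell2_nth (\<xi> h) []" "ell2_single i 1"]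
    by (simp add: scalar_defect_fixes xi_in)
  also have "\<dots> = cnj (cinner \<Omega> (Ad i h))"
    using cinner_W_Vt[OF y, of h i] h
    by (simp add: W_base dilation_def cinner_prod_def creation_zero cinner_ell2_single_right H_iff
        cinner_complex_def)
  finally show "ell2_nth (ell2_nth (\<xi> h) []) i = ell2_nth (Dh h) i"
    by (simp add: cinner_ell2_single_right cinner_complex_def D_hat_star_nth h)
qed

lemma xi_nth: "h \<in> H \<Longrightarrow> ell2_nth (\<xi> h) \<alpha> = Dh (ring.adj_word \<alpha> h)"
proof (induction \<alpha> arbitrary: h)
  case (Cons i \<alpha>)
  have "ell2_nth (\<xi> h) (i # \<alpha>) = ell2_nth (\<xi> (ring_adj i h)) \<alpha>"
    by (subst xi_Cons, subst Ad_decomp) (simp only: xi_add_Omega)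
  then show ?case
    by (simp add: Cons.IH ring_adj_in)
qed (simp add: xi_Nil)

section \<open>Comparison of the characteristic functions component by component\<close>

lemma C_ring_nth:
  assumes h: "h \<in> H"
  shows "ell2_nth (C_ring A \<Omega> h) \<alpha> = DS (ring.adj_word \<alpha> h)"
proof -
  let ?v = "Abs_ell2 (\<lambda>\<alpha>. DS (ring.adj_word \<alpha> h))"
  \<comment> \<open>Square summability is inherited from \<open>\<xi> h\<close>, whose entries have
    the same norms.\<close>
  have "is_ell2 (\<lambda>\<alpha>. DS (ring.adj_word \<alpha> h))"
    by (rule is_ell2_mono[OF is_ell2_nth[of "\<xi> h"]])
      (simp add: xi_nth h norm_D_hat_star ring.adj_word_in)
  then have nth: "ell2_nth ?v \<alpha> = DS (ring.adj_word \<alpha> h)" for \<alpha>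
    by (rule Abs_ell2_nth)
  have "C_ring A \<Omega> h = ?v"
    unfolding C_ring_def using ell2_has_sum_single[of ?v]
    by (intro infsumI) (simp add: nth ring.adj_on_word_op h)
  then show ?thesis
    by (simp add: nth)
qed

lemma gamma_tensor_eqI:
  assumes "\<And>\<alpha>. gamma_iso A \<Omega> \<omega> (ell2_nth f \<alpha>) = ell2_nth g \<alpha>"
  shows "id_tensor (gamma_iso A \<Omega> \<omega>) f = g"
  by (simp add: id_tensor_def assms ell2_nth_inverse)

lemma gamma_C_ring: "h \<in> H \<Longrightarrow> id_tensor (gamma_iso A \<Omega> \<omega>) (C_ring A \<Omega> h) = \<xi> h"
  by (rule gamma_tensor_eqI) (simp add: C_ring_nth gamma_iso_eq ring.adj_word_in xi_nth)

lemma theta_hat_eq: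
  assumes h: "h \<in> H"
  shows "theta_hat W (defect_on UNIV A (ell2_single i h)) = (0, creation i (\<xi> h) - \<xi> (A i h))"
proof -
  let ?e = "ell2_single [] (defect_on UNIV A (ell2_single i h))"
  have V: "V i (h, 0) = (A i h, ?e)"
    by (simp add: dilation_def creation_zero)
  have "(0, ?e) = V i (h, 0) + (- 1) *\<^sub>C (A i h, 0)"
    unfolding V by (simp add: scaleC_prod_def scaleC_minus1)
  then have "W (0, ?e) = W (V i (h, 0)) + (- 1) *\<^sub>C W (A i h, 0)"
    by (simp only: clinear_on_add[OF W_clinear] clinear_on_scaleC[OF W_clinear] base_in_dom
        V_in_dom dom_scaleC)
  \<comment> \<open>For \<open>h\<close> orthogonal to \<open>\<Omega>\<close> the vector
    \<open>W (h, 0)\<close> has scalar part 0, so \<open>Vt i\<close> acts on it as the creation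
    operator alone.\<close>
  also have "W (V i (h, 0)) = (0, creation i (\<xi> h))"
    using h by (subst W_V[OF base_in_dom])
      (simp add: W_base H_iff dilation_def scalar.defect_on_zero)
  also have "W (A i h, 0) = (0, \<xi> (A i h))"
    using A_in_H[OF h] by (simp add: W_base H_iff)
  finally show ?thesis
    by (simp add: theta_hat_def scaleC_prod_def scaleC_minus1)
qed

text \<open>Both sides are compared entry by entry. The entries of \<open>theta_ring\<close> turn
  out to be values of \<open>DS\<close>, where \<open>gamma_iso\<close> is known explicitly.\<close>

lemma gamma_theta_ring:
  assumes h: "h \<in> H"
  shows "id_tensor (gamma_iso A \<Omega> \<omega>) (theta_ring A \<Omega> (D_ring A \<Omega> (ell2_single i h)))
    = creation i (\<xi> h) - \<xi> (A i h)"
proof -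
  define f where "f = D_ring A \<Omega> (ell2_single i h)"
  define E where "E = creation i (\<xi> h) - \<xi> (A i h)"
  \<comment> \<open>The \<open>j\<close>-th entry of the squared defect, identity minus column times
    row, applied to \<open>ell2_single i h\<close>.\<close>
  define g where "g j = (if j = i then h else 0) - ring_adj j (A i h)" for j
  have Ah: "A i h \<in> H"
    using h by (rule A_in_H)
  have gH: "g j \<in> H" for j
    by (simp add: g_def csubspace_diff[OF H_subspace] csubspace_zero[OF H_subspace] h ring_adj_in)
  have single: "ell2_single i h \<in> dsum H"
    by (rule ell2_single_in_dsum[OF H_subspace h])
  have row_single: "row_op (A_ring A \<Omega>) (ell2_single i h) = A i h"
    by (simp add: ring.row_op_single h) (simp add: A_ring_def h)
  \<comment> \<open>Moving the row operator across the defect puts the vacuum entry into the range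
    of \<open>DS\<close>.\<close>
  have "row_op (A_ring A \<Omega>) f = DS (A i h)"
    by (simp add: f_def D_ring_def ring.row_op_defect_on single row_single DS_eq)
  then have vac: "(\<Sum>\<^sub>\<infinity>j. A_ring A \<Omega> j (ell2_nth f j)) = DS (A i h)"
    by (simp add: row_op_def)
  have "D_ring A \<Omega> f = ell2_single i h - ring.column (A i h)"
    by (simp add: f_def D_ring_def ring.defect_on_square single row_single)
  then have Df: "ell2_nth (D_ring A \<Omega> f) j = g j" for j
    by (simp add: g_def ring.column_nth Ah)
  define u where "u \<alpha> = (case \<alpha> of [] \<Rightarrow> 0 | j # \<beta> \<Rightarrow> DS (ring.adj_word \<beta> (g j)))" for \<alpha>
  have E_Nil: "ell2_nth E [] = - Dh (A i h)"
    by (simp add: E_def xi_nth Ah)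
  have E_Cons: "ell2_nth E (j # \<beta>) = Dh (ring.adj_word \<beta> (g j))" for j \<beta>
  proof -
    have "Dh (ring.adj_word \<beta> (g j))
        = Dh (ring.adj_word \<beta> (if j = i then h else 0)) - Dh (ring.adj_word \<beta> (ring_adj j (A i h)))"
      unfolding g_def
      by (rule clinear_on_diff[OF D_hat_star_word_clinear H_subspace])
        (simp_all add: h csubspace_zero[OF H_subspace] ring_adj_in)
    then show ?thesis
      using clinear_on_zero[OF D_hat_star_word_clinear csubspace_zero[OF H_subspace], of \<beta>]
      by (simp add: E_def xi_nth Ah h)
  qed
  \<comment> \<open>Off the empty word \<open>u\<close> has the same norms as \<open>E\<close>, and
    at the empty word it is 0.\<close>
  have "is_ell2 u"
  proof (rule is_ell2_mono[OF is_ell2_nth[of E]])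
    show "norm (u \<alpha>) \<le> norm (ell2_nth E \<alpha>)" for \<alpha>
      by (cases \<alpha>) (simp_all add: u_def E_Cons norm_D_hat_star ring.adj_word_in gH)
  qed
  then have u_nth: "ell2_nth (Abs_ell2 u) \<alpha> = u \<alpha>" for \<alpha>
    by (rule Abs_ell2_nth)
  \<comment> \<open>The fibres of \<open>hd\<close> collect the words by first letter. The value of
    \<open>hd\<close> at the empty word is immaterial, since \<open>u\<close> vanishes
    there.\<close>
  have "((\<lambda>j. creation j (C_ring A \<Omega> (g j))) has_sum Abs_ell2 u) UNIV"
  proof (rule ell2_has_sum_fibres[where p = hd])
    show "ell2_nth (creation j (C_ring A \<Omega> (g j))) \<alpha> = (if hd \<alpha> = j then ell2_nth (Abs_ell2 u) \<alpha> else 0)"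
      for j \<alpha>
      by (cases \<alpha>) (auto simp: u_nth u_def C_ring_nth gH)
  qed
  then have theta: "theta_ring A \<Omega> f = - ell2_single [] (DS (A i h)) + Abs_ell2 u"
    unfolding theta_ring_def vac Df C_ring_def[symmetric] by (simp add: infsumI)
  have "gamma_iso A \<Omega> \<omega> (ell2_nth (theta_ring A \<Omega> f) \<alpha>) = ell2_nth E \<alpha>" for \<alpha>
  proof (cases \<alpha>)
    case Nil
    \<comment> \<open>\<open>gamma_iso\<close> has been evaluated only on values of
      \<open>DS\<close>, so the sign is moved inside the argument.\<close>
    have "- DS (A i h) = DS (- A i h)" "- Dh (A i h) = Dh (- A i h)"
      by (simp_all add: clinear_on_uminus[OF DS_clinear] clinear_on_uminus[OF D_hat_star_clinear] Ah)
    then show ?thesis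
      by (simp add: Nil theta u_nth u_def E_Nil gamma_iso_eq csubspace_uminus[OF H_subspace] Ah)
  qed (simp add: theta u_nth u_def E_Cons gamma_iso_eq ring.adj_word_in gH)
  then show ?thesis
    unfolding f_def E_def by (rule gamma_tensor_eqI)
qed

end

theorem theorem5p2:
  fixes A :: "'i::countable \<Rightarrow> 'h::chilbert_space \<Rightarrow> 'h"
    and \<Omega> :: 'h
    and \<omega> :: "'i \<Rightarrow> complex"
    and W :: "'h \<times> ('i, ('i, 'h) ell2) fock \<Rightarrow> complex \<times> ('i, ('i, complex) ell2) fock"
  assumes d_ge_2: "infinite (UNIV :: 'i set) \<or> CARD('i) \<ge> 2"
    and separable: "\<exists>B :: 'h set. countable B \<and> closure B = UNIV"
    and A_bounded: "\<And>i. bounded_clinear_on UNIV UNIV (A i)"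
    and A_coisometric: "coisometric A"
    and A_ergodic: "ergodic A"
    and Omega_unit: "norm \<Omega> = 1"
    and omega_unit: "((\<lambda>i. (cmod (\<omega> i))\<^sup>2) has_sum 1) UNIV"
    and eigen: "\<And>i. adj (A i) \<Omega> = cnj (\<omega> i) *\<^sub>C \<Omega>"
    and W: "intertwining_unitary A \<Omega> \<omega> W"
  shows "\<forall>h \<in> H_ring \<Omega>.
      gamma_iso A \<Omega> \<omega> (D_ring_star A \<Omega> h) = D_hat_star A \<Omega> \<omega> h
    \<and> C_hat W h = (0, id_tensor (gamma_iso A \<Omega> \<omega>) (C_ring A \<Omega> h))
    \<and> (\<forall>i. theta_hat W (defect_on UNIV A (ell2_single i h))
           = (0, id_tensor (gamma_iso A \<Omega> \<omega>) (theta_ring A \<Omega> (D_ring A \<Omega> (ell2_single i h)))))"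
proof -
  interpret intertwined_tuple A \<Omega> \<omega> W
    by standard (fact A_bounded A_coisometric Omega_unit omega_unit eigen W)+
  show ?thesis
    by (auto simp: gamma_iso_eq C_hat_def W_base gamma_C_ring theta_hat_eq gamma_theta_ring H_iff)
qed

end
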